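(* Let $y>0$, $n\ge1$ an integer, and $0<\varepsilon<\min\{y/(n+1),1\}$. Let $X$ be a Lévy process with triplet $(\sigma^2,b,\nu)$ such that $\nu$ has a density $s$ satisfying $\sup_{|x|>\delta}|s^{(k)}(x)|<\infty$ for every integer $0\le k\le 2n+1$ and every $\delta>0$. Assume also that there exists $t_0>0$ such that for all $0<t<t_0$, $X_t$ has a $C^{2n+1}$ density $p_t$, and that for every $0\le k\le2n+1$ and $\delta>0$, $$\sup_{0<u<t_0}\ \sup_{|x|>\delta}|p_u^{(k)}(x)|<\infty .$$ Then, for $0<t<t_0$, the remainder $$\mathcal R_n(t,y):=\lim_{m\to\infty}\int_0^1(1-\alpha)^n\,\mathbb{E}\big[(L^{n+1}f_m)(X_{\alpha t})\big]\,d\alpha$$ is given by $$\mathcal R_n(t,y)=\sum_{\mathbf k\in\mathcal K_{n+1}}c_{\mathbf k}\binom{n+1}{\mathbf k}\int_0^1(1-\alpha)^n\,a_{\mathbf k}(t;\alpha,y)\,d\alpha,$$ where, for $\mathbf k=(k_0,\dots,k_4)\in\mathcal K_{n+1}$ and $\ell:=k_1+2k_2+2k_4$, $$c_{\mathbf k}:=b_0^{k_0}b_1^{k_1}b_2^{k_2}(-1)^{(k_1-1)\mathbf 1\{\ell>0\}},$$ $$a_{\mathbf k}(t;\alpha,y):=\begin{cases}\displaystyle\int\mathbb{P}\Big(X_{\alpha t}+\sum_{i=1}^{k_3}u_i\ge y\Big)\,d\pi_{\mathbf k},&\ell=0,\\[2mm]\displaystyle\int\mathbb{E}\Big[(\bar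 c_\varepsilon s)^{(\ell-1)}\Big(y-X_{\alpha t}-\sum_{i=2}^{k_3}u_i-\sum_{j=1}^{k_4}\beta_jw_j\Big)\Big]\,d\tilde\pi_{\mathbf k},&k_3>0,\ \ell>0,\\[2mm]\displaystyle\int p_{\alpha t}^{(\ell-1)}\Big(y-\sum_{j=1}^{k_4}\beta_jw_j\Big)\,d\pi_{\mathbf k},&k_3=0,\ \ell>0.\end{cases}$$
   Context: A Lévy process $X=(X_t)_{t\ge0}$ has triplet $(\sigma^2,b,\nu)$ if $X_t=bt+\sigma W_t+\int_0^t\int_{|x|\le1}x\,(\mu-\bar\mu)(dx,ds)+\int_0^t\int_{|x|>1}x\,\mu(dx,ds)$, where $W$ is a standard Brownian motion and $\mu$ is an independent Poisson random measure on $\mathbb{R}_+\times(\mathbb{R}\setminus\{0\})$ with mean measure $\bar\mu(dx,dt)=\nu(dx)\,dt$, $\nu$ being a Lévy measure. Its infinitesimal generator is $$(Lg)(x)=\frac{\sigma^2}{2}g''(x)+bg'(x)+\int\big(g(u+x)-g(x)-ug'(x)\mathbf 1_{\{|u|\le1\}}\big)\nu(du)$$ for $g\in C_b^2$, and $L^k$ is its $k$-th iterate. Mollified indicators: $\varphi\in C^\infty(\mathbb{R})$ is a symmetric nonnegative bump function with support in $[-1,1]$ and $\int\varphi=1$; $\varphi_m(x):=m\varphi(mx)$ and $f_m(x):=\int_{-\infty}^{x-y}\varphi_m(u)\,du$. Fix a truncation function $c_\varepsilon\in C^\infty(\mathbb{R})$ with $\mathbf 1_{[-\varepsilon/2,\varepsilon/2]}\le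 c_\varepsilon\le\mathbf 1_{[-\varepsilon,\varepsilon]}$, $\bar c_\varepsilon:=1-c_\varepsilon$ (the function $\bar c_\varepsilon s$ is set to $0$ at $0$), and put $b_0:=-\int\bar c_\varepsilon(u)\,\nu(du)$, $b_1:=b-\int u\,(\mathbf 1_{\{|u|\le1\}}-c_\varepsilon(u))\,\nu(du)$, $b_2:=\sigma^2/2$. $\mathcal K_{k}$ is the set of $\mathbf k=(k_0,\dots,k_4)$ of nonnegative integers with $k_0+\dots+k_4=k$, and $\binom{k}{\mathbf k}=k!/(k_0!\cdots k_4!)$. For $\mathbf u=(u_1,\dots,u_{k_3})$, $\mathbf w=(w_1,\dots,w_{k_4})$, $\beta=(\beta_1,\dots,\beta_{k_4})$ define the finite measures $$d\pi_{\mathbf k}(\mathbf u,\mathbf w,\beta)=\prod_{i=1}^{k_3}\bar c_\varepsilon(u_i)\nu(du_i)\prod_{j=1}^{k_4}c_\varepsilon(w_j)w_j^2\nu(dw_j)\prod_{j=1}^{k_4}(1-\beta_j)d\beta_j$$ on $\mathbb{R}^{k_3+k_4}\times[0,1]^{k_4}$, and $$d\tilde\pi_{\mathbf k}(u_2,\dots,u_{k_3},\mathbf w,\beta)=\prod_{i=2}^{k_3}\bar c_\varepsilon(u_i)\nu(du_i)\prod_{j=1}^{k_4}c_\varepsilon(w_j)w_j^2\nu(dw_j)\prod_{j=1}^{k_4}(1-\beta_j)d\beta_j .$$ Conventions: $\int g\,d\pi_{\mathbf k}=g$ when $k_3=k_4=0$; $\int g\,d\tilde\pi_{\mathbf k}=g$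 when $k_4=0$ and $k_3\in\{0,1\}$; empty sums are $0$. *)

theory Defs
  imports "HOL-Probability.Probability"
begin

section \<open>Levy processes and their characteristic triplets\<close>

definition is_levy_measure :: "real measure \<Rightarrow> bool" where
  "is_levy_measure \<nu> \<longleftrightarrow>
     sets \<nu> = sets borel \<and> emeasure \<nu> {0} = 0 \<and>
     (\<integral>\<^sup>+ x. ennreal (min 1 (x^2)) \<partial>\<nu>) < \<infinity>"

definition cadlag :: "(real \<Rightarrow> real) \<Rightarrow> bool" where
  "cadlag f \<longleftrightarrow>
     (\<forall>t\<ge>0. continuous (at_right t) f) \<and> (\<forall>t>0. \<exists>l. (f \<longlongrightarrow> l) (at_left t))"

definition independent_increments :: "'a measure \<Rightarrow> (real \<Rightarrow> 'a \<Rightarrow> real) \<Rightarrow> bool" where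
  "independent_increments M X \<longleftrightarrow>
     (\<forall>(\<tau> :: nat \<Rightarrow> real) k. 0 \<le> \<tau> 0 \<and> mono \<tau> \<longrightarrow>
        prob_space.indep_vars M (\<lambda>_. borel) (\<lambda>i \<omega>. X (\<tau> (Suc i)) \<omega> - X (\<tau> i) \<omega>) {..<k})"

text \<open>Time runs over \<open>[0, \<infinity>)\<close>; the values of a process at negative times are irrelevant.\<close>

definition levy_process :: "'a measure \<Rightarrow> (real \<Rightarrow> 'a \<Rightarrow> real) \<Rightarrow> bool" where
  "levy_process M X \<longleftrightarrow>
     prob_space M \<and>
     (\<forall>t\<ge>0. X t \<in> borel_measurable M) \<and>
     (AE \<omega> in M. X 0 \<omega> = 0) \<and>
     (AE \<omega> in M. cadlag (\<lambda>t. X t \<omega>)) \<and>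
     independent_increments M X \<and>
     (\<forall>r\<ge>0. \<forall>h\<ge>0. distr M borel (\<lambda>\<omega>. X (r + h) \<omega> - X r \<omega>) = distr M borel (\<lambda>\<omega>. X h \<omega> - X 0 \<omega>))"

definition brownian_motion :: "'a measure \<Rightarrow> (real \<Rightarrow> 'a \<Rightarrow> real) \<Rightarrow> bool" where
  "brownian_motion M W \<longleftrightarrow>
     prob_space M \<and>
     (\<forall>t\<ge>0. W t \<in> borel_measurable M) \<and>
     (AE \<omega> in M. W 0 \<omega> = 0) \<and>
     (AE \<omega> in M. continuous_on {0..} (\<lambda>t. W t \<omega>)) \<and>
     independent_increments M W \<and>
     (\<forall>r t. 0 \<le> r \<and> r < t \<longrightarrow>
        distributed M lborel (\<lambda>\<omega>. W t \<omega> - W r \<omega>) (normal_density 0 (sqrt (t - r))))"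

text \<open>A Poisson random measure with mean measure \<open>N\<close>, given as a family of measures indexed by
  the sample points.\<close>

definition poisson_random_measure :: "'a measure \<Rightarrow> 'b measure \<Rightarrow> ('a \<Rightarrow> 'b measure) \<Rightarrow> bool" where
  "poisson_random_measure M N \<mu> \<longleftrightarrow>
     prob_space M \<and>
     (\<forall>\<omega>\<in>space M. sets (\<mu> \<omega>) = sets N) \<and>
     (\<forall>A\<in>sets N. (\<lambda>\<omega>. emeasure (\<mu> \<omega>) A) \<in> borel_measurable M) \<and>
     (\<forall>A\<in>sets N. emeasure N A = \<infinity> \<longrightarrow> (AE \<omega> in M. emeasure (\<mu> \<omega>) A = \<infinity>)) \<and>
     (\<forall>A\<in>sets N. emeasure N A < \<infinity> \<longrightarrow>
        (\<forall>k :: nat. measure M {\<omega> \<in> space M. emeasure (\<mu> \<omega>) A = of_nat k}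
                   = exp (- measure N A) * measure N A ^ k / fact k)) \<and>
     (\<forall>A :: nat \<Rightarrow> 'b set. range A \<subseteq> sets N \<and> disjoint_family A \<longrightarrow>
        prob_space.indep_vars M (\<lambda>_. borel) (\<lambda>i \<omega>. emeasure (\<mu> \<omega>) (A i)) UNIV)"

text \<open>The measure \<open>dt \<nu>(dx)\<close> on \<open>[0, \<infinity>) \<times> (\<real> - {0})\<close>; points are pairs (time, jump size).\<close>

definition jump_intensity :: "real measure \<Rightarrow> (real \<times> real) measure" where
  "jump_intensity \<nu> = restrict_space lborel {0..} \<Otimes>\<^sub>M restrict_space \<nu> (- {0})"

text \<open>The integral of the jump size \<open>x\<close> over \<open>[0, t] \<times> {\<delta> < \<bar>x\<bar> \<le> 1}\<close> against \<open>\<mu> - jump_intensity \<nu>\<close>.\<close>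

definition compensated_jumps ::
    "real measure \<Rightarrow> ('a \<Rightarrow> (real \<times> real) measure) \<Rightarrow> real \<Rightarrow> real \<Rightarrow> 'a \<Rightarrow> real" where
  "compensated_jumps \<nu> \<mu> \<delta> t \<omega> =
     (LINT z:{0..t} \<times> {x. \<delta> < \<bar>x\<bar> \<and> \<bar>x\<bar> \<le> 1}|\<mu> \<omega>. snd z)
     - (LINT z:{0..t} \<times> {x. \<delta> < \<bar>x\<bar> \<and> \<bar>x\<bar> \<le> 1}|jump_intensity \<nu>. snd z)"

text \<open>The Levy-Ito decomposition with triplet \<open>(\<sigma>\<^sup>2, b, \<nu>)\<close>.  The compensated small jump integral
  \<open>J t\<close> is the limit of \<^const>\<open>compensated_jumps\<close> in mean square as \<open>\<delta>\<close> decreases to 0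
  (the jumps near 0 need not be absolutely summable), so it is determined up to null sets.
  Independence of \<open>W\<close> and \<open>\<mu>\<close> is independence of the sigma-algebras generated by the families
  \<open>(W t)\<close> and \<open>(\<mu> A)\<close>.\<close>

definition has_levy_triplet ::
    "'a measure \<Rightarrow> (real \<Rightarrow> 'a \<Rightarrow> real) \<Rightarrow> real \<Rightarrow> real \<Rightarrow> real measure \<Rightarrow> bool" where
  "has_levy_triplet M X \<sigma> b \<nu> \<longleftrightarrow>
     is_levy_measure \<nu> \<and>
     (\<exists>W \<mu> J.
        brownian_motion M W \<and>
        poisson_random_measure M (jump_intensity \<nu>) \<mu> \<and>
        prob_space.indep_set M
          (sets (vimage_algebra (space M) (\<lambda>\<omega>. \<lambda>t\<in>{0..}. W t \<omega>) (PiM {0..} (\<lambda>_. borel))))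
          (sets (vimage_algebra (space M)
             (\<lambda>\<omega>. \<lambda>A\<in>sets (jump_intensity \<nu>). emeasure (\<mu> \<omega>) A)
             (PiM (sets (jump_intensity \<nu>)) (\<lambda>_. borel)))) \<and>
        (\<forall>t\<ge>0. J t \<in> borel_measurable M \<and>
           ((\<lambda>\<delta>. \<integral>\<^sup>+ \<omega>. ennreal ((compensated_jumps \<nu> \<mu> \<delta> t \<omega> - J t \<omega>)^2) \<partial>M) \<longlongrightarrow> 0) (at_right 0)) \<and>
        (\<forall>t\<ge>0. AE \<omega> in M.
           X t \<omega> = b * t + \<sigma> * W t \<omega> + J t \<omega> + (LINT z:{0..t} \<times> {x. 1 < \<bar>x\<bar>}|\<mu> \<omega>. snd z)))"

text \<open>Meaningful for bounded \<open>g\<close> of class \<open>C\<^sup>2\<close> with bounded derivatives; the k-th iterate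
  is the \<open>k\<close>-fold \<open>^^\<close>.\<close>

definition levy_generator ::
    "real \<Rightarrow> real \<Rightarrow> real measure \<Rightarrow> (real \<Rightarrow> real) \<Rightarrow> real \<Rightarrow> real" where
  "levy_generator \<sigma> b \<nu> g = (\<lambda>x.
     \<sigma>^2 / 2 * deriv (deriv g) x + b * deriv g x
     + (LINT u|\<nu>. g (u + x) - g x - u * deriv g x * indicator {u. \<bar>u\<bar> \<le> 1} u))"


section \<open>Smooth functions, mollified indicators and truncation\<close>

definition smooth :: "(real \<Rightarrow> real) \<Rightarrow> bool" where
  "smooth f \<longleftrightarrow> (\<forall>k x. (deriv ^^ k) f differentiable (at x))"

definition class_C :: "nat \<Rightarrow> (real \<Rightarrow> real) \<Rightarrow> bool" where
  "class_C k f \<longleftrightarrow>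
     (\<forall>j<k. \<forall>x. (deriv ^^ j) f differentiable (at x)) \<and> continuous_on UNIV ((deriv ^^ k) f)"

definition bump :: "(real \<Rightarrow> real) \<Rightarrow> bool" where
  "bump \<phi> \<longleftrightarrow>
     smooth \<phi> \<and> (\<forall>x. \<phi> (- x) = \<phi> x) \<and> (\<forall>x. 0 \<le> \<phi> x) \<and>
     (\<forall>x. 1 < \<bar>x\<bar> \<longrightarrow> \<phi> x = 0) \<and> (LBINT x. \<phi> x) = 1"

definition mollified_indicator :: "(real \<Rightarrow> real) \<Rightarrow> real \<Rightarrow> nat \<Rightarrow> real \<Rightarrow> real" where
  "mollified_indicator \<phi> y m x = (LBINT u:{..x - y}. real m * \<phi> (real m * u))"

definition truncation :: "real \<Rightarrow> (real \<Rightarrow> real) \<Rightarrow> bool" where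
  "truncation \<epsilon> c \<longleftrightarrow>
     smooth c \<and>
     (\<forall>x. indicator {- \<epsilon> / 2..\<epsilon> / 2} x \<le> c x \<and> c x \<le> indicator {- \<epsilon>..\<epsilon>} x)"

definition b0 :: "(real \<Rightarrow> real) \<Rightarrow> real measure \<Rightarrow> real" where
  "b0 c \<nu> = - (LINT u|\<nu>. 1 - c u)"

definition b1 :: "real \<Rightarrow> (real \<Rightarrow> real) \<Rightarrow> real measure \<Rightarrow> real" where
  "b1 b c \<nu> = b - (LINT u|\<nu>. u * (indicator {u. \<bar>u\<bar> \<le> 1} u - c u))"

definition b2 :: "real \<Rightarrow> real" where
  "b2 \<sigma> = \<sigma>^2 / 2"


section \<open>The terms of the expansion\<close>

type_synonym idx = "nat \<times> nat \<times> nat \<times> nat \<times> nat"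

definition idx_set :: "nat \<Rightarrow> idx set" where
  "idx_set k = {(k0, k1, k2, k3, k4). k0 + k1 + k2 + k3 + k4 = k}"

fun multinom :: "idx \<Rightarrow> real" where
  "multinom (k0, k1, k2, k3, k4) =
     fact (k0 + k1 + k2 + k3 + k4) / (fact k0 * fact k1 * fact k2 * fact k3 * fact k4)"

fun ell :: "idx \<Rightarrow> nat" where
  "ell (k0, k1, k2, k3, k4) = k1 + 2 * k2 + 2 * k4"

text \<open>The three marginals.  For an empty index set \<^const>\<open>PiM\<close> is the unit point mass, which gives
  the usual conventions for integrals over no variables.\<close>

definition big_part :: "(real \<Rightarrow> real) \<Rightarrow> real measure \<Rightarrow> real measure" where
  "big_part c \<nu> = density \<nu> (\<lambda>u. ennreal (1 - c u))"

definition small_part :: "(real \<Rightarrow> real) \<Rightarrow> real measure \<Rightarrow> real measure" where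
  "small_part c \<nu> = density \<nu> (\<lambda>w. ennreal (c w * w^2))"

definition beta_part :: "real measure" where
  "beta_part = density lborel (\<lambda>\<beta>. ennreal ((1 - \<beta>) * indicator {0..1} \<beta>))"

fun pi_meas :: "(real \<Rightarrow> real) \<Rightarrow> real measure \<Rightarrow> idx \<Rightarrow>
    ((nat \<Rightarrow> real) \<times> (nat \<Rightarrow> real) \<times> (nat \<Rightarrow> real)) measure" where
  "pi_meas c \<nu> (k0, k1, k2, k3, k4) =
     PiM {1..k3} (\<lambda>_. big_part c \<nu>) \<Otimes>\<^sub>M
     (PiM {1..k4} (\<lambda>_. small_part c \<nu>) \<Otimes>\<^sub>M PiM {1..k4} (\<lambda>_. beta_part))"

fun pi_tilde :: "(real \<Rightarrow> real) \<Rightarrow> real measure \<Rightarrow> idx \<Rightarrow>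
    ((nat \<Rightarrow> real) \<times> (nat \<Rightarrow> real) \<times> (nat \<Rightarrow> real)) measure" where
  "pi_tilde c \<nu> (k0, k1, k2, k3, k4) =
     PiM {2..k3} (\<lambda>_. big_part c \<nu>) \<Otimes>\<^sub>M
     (PiM {1..k4} (\<lambda>_. small_part c \<nu>) \<Otimes>\<^sub>M PiM {1..k4} (\<lambda>_. beta_part))"

text \<open>The exponent of \<open>-1\<close> is an integer because \<open>k\<^sub>1 - 1\<close> may be negative.\<close>

fun c_coeff :: "real \<Rightarrow> real \<Rightarrow> (real \<Rightarrow> real) \<Rightarrow> real measure \<Rightarrow> idx \<Rightarrow> real" where
  "c_coeff \<sigma> b c \<nu> (k0, k1, k2, k3, k4) =
     b0 c \<nu> ^ k0 * b1 b c \<nu> ^ k1 * b2 \<sigma> ^ k2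
     * (-1) powi ((int k1 - 1) * (if 0 < ell (k0, k1, k2, k3, k4) then 1 else 0))"

fun a_coeff :: "'a measure \<Rightarrow> (real \<Rightarrow> 'a \<Rightarrow> real) \<Rightarrow> (real \<Rightarrow> real \<Rightarrow> real) \<Rightarrow> (real \<Rightarrow> real) \<Rightarrow>
    (real \<Rightarrow> real) \<Rightarrow> real measure \<Rightarrow> idx \<Rightarrow> real \<Rightarrow> real \<Rightarrow> real \<Rightarrow> real" where
  "a_coeff M X p s c \<nu> (k0, k1, k2, k3, k4) t \<alpha> y =
     (let l = ell (k0, k1, k2, k3, k4) in
      if l = 0 then
        (LINT (u, w, \<beta>)|pi_meas c \<nu> (k0, k1, k2, k3, k4).
           measure M {\<omega> \<in> space M. X (\<alpha> * t) \<omega> + (\<Sum>i=1..k3. u i) \<ge> y})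
      else if 0 < k3 then
        (LINT (u, w, \<beta>)|pi_tilde c \<nu> (k0, k1, k2, k3, k4).
           (LINT \<omega>|M. (deriv ^^ (l - 1)) (\<lambda>x. (1 - c x) * s x)
              (y - X (\<alpha> * t) \<omega> - (\<Sum>i=2..k3. u i) - (\<Sum>j=1..k4. \<beta> j * w j))))
      else
        (LINT (u, w, \<beta>)|pi_meas c \<nu> (k0, k1, k2, k3, k4).
           (deriv ^^ (l - 1)) (p (\<alpha> * t)) (y - (\<Sum>j=1..k4. \<beta> j * w j))))"

end

theory Submission
  imports Defs
begin

text \<open>Taylor's formula with integral remainder splits the generator on smooth functions with bounded
  derivatives as \<open>b\<^sub>0 + b\<^sub>1 D + b\<^sub>2 D\<^sup>2 + S + K D\<^sup>2\<close>, where \<open>S\<close> and \<open>K\<close> are convolutions with finite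
  measures: \<open>S\<close> with the large jumps, \<open>K\<close> with the law of \<open>\<beta> w\<close> for small jumps \<open>w\<close>.  These operators
  commute, so the iterate expands multinomially into terms \<open>S\<^sup>i K\<^sup>j D\<^sup>l\<close>, and the expectation at \<open>X u\<close> is
  one more convolution, commuting with the others.  The derivatives of the mollified indicator are
  moved by parts onto the density of a large jump if there is one, and onto the density of \<open>X u\<close>
  otherwise; what remains is an approximate identity, and dominated convergence applies.\<close>

section \<open>Smooth functions with bounded derivatives\<close>

text \<open>The l-th derivative of the mollified indicator grows like m^l, so a term with l > 0 has
  no bound uniform in m until its derivatives have been moved elsewhere. The bound must also be
  uniform in the time \<open>\<alpha> * t\<close> down to 0, where the law of X collapses to the
  origin. A large jump offers a density that vanishes near 0, because 1 - c does, and that is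
  bounded together with the derivatives needed. Without a large jump the only density at hand is
  that of X, which is controlled uniformly in time only away from 0. But then the argument is
  displaced only by small jumps, at most n + 1 of them and each by at most \<epsilon>, and (n + 1)
  \<epsilon> < y keeps it away from 0. Writing the expectation at \<open>X u\<close> as a
  convolution with the law of \<open>X u\<close>, evaluated at 0, makes it interchangeable with S
  and K; in each term, whichever measure has to absorb the derivatives can then be brought next to
  the mollified indicator.\<close>

lemma has_real_derivative_funpow_deriv:
  assumes "smooth f"
  shows "((deriv ^^ k) f has_real_derivative (deriv ^^ Suc k) f x) (at x)"
  using assms by (simp add: smooth_def DERIV_deriv_iff_real_differentiable)

lemma continuous_funpow_deriv:
  assumes "smooth f"
  shows "continuous_on UNIV ((deriv ^^ k) f)"
  using has_real_derivative_funpow_deriv[OF assms]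
  by (meson DERIV_isCont continuous_at_imp_continuous_on)

lemma smooth_deriv: "smooth f \<Longrightarrow> smooth (deriv f)"
  unfolding smooth_def by (metis comp_apply funpow_Suc_right)

lemma smooth_funpow_deriv: "smooth f \<Longrightarrow> smooth ((deriv ^^ k) f)"
  by (induction k) (auto intro: smooth_deriv)

text \<open>Guessing the whole ladder of derivatives at once reduces iterated derivatives to a
  one-step check; \<open>smoothI\<close> draws smoothness from the same ladder.\<close>

lemma funpow_deriv_eqI:
  fixes F :: "nat \<Rightarrow> real \<Rightarrow> real"
  assumes "\<And>k x. (F k has_real_derivative F (Suc k) x) (at x)"
  shows "(deriv ^^ k) (F 0) = F k"
proof (induction k)
  case (Suc k)
  then show ?case using assms[THEN DERIV_imp_deriv] by auto
qed simp

lemma smoothI: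
  fixes F :: "nat \<Rightarrow> real \<Rightarrow> real"
  assumes "\<And>k x. (F k has_real_derivative F (Suc k) x) (at x)"
  shows "smooth (F 0)"
  unfolding smooth_def funpow_deriv_eqI[of F, OF assms]
  using assms real_differentiable_def by blast

text \<open>Bounded derivatives of all orders, rather than of order two: differentiation,
  convolution and hence the generator map this class into itself, so iterates lose no
  regularity.\<close>

definition smooth_bdd :: "(real \<Rightarrow> real) \<Rightarrow> bool" where
  "smooth_bdd f \<longleftrightarrow> smooth f \<and> (\<forall>k. bounded (range ((deriv ^^ k) f)))"

lemma smooth_bdd_smooth: "smooth_bdd f \<Longrightarrow> smooth f"
  by (simp add: smooth_bdd_def)

lemma smooth_bdd_funpow_deriv: "smooth_bdd f \<Longrightarrow> smooth_bdd ((deriv ^^ k) f)"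
  by (simp add: smooth_bdd_def smooth_funpow_deriv flip: funpow_add comp_apply[of "(deriv ^^ _)" "deriv ^^ _"])

lemma smooth_bdd_deriv: "smooth_bdd f \<Longrightarrow> smooth_bdd (deriv f)"
  using smooth_bdd_funpow_deriv[of f 1] by simp

lemma smooth_bdd_has_derivative:
  "smooth_bdd f \<Longrightarrow> (f has_real_derivative deriv f x) (at x)"
  using has_real_derivative_funpow_deriv[of f 0] by (simp add: smooth_bdd_def)

text \<open>Limits such as indicators leave the smooth class, so convolution must also act on this
  larger one; boundedness is all that integrability against finite measures and Fubini
  require.\<close>

definition bdd_borel :: "(real \<Rightarrow> real) \<Rightarrow> bool" where
  "bdd_borel F \<longleftrightarrow> F \<in> borel_measurable borel \<and> bounded (range F)"

lemma bdd_borel_measurable: "bdd_borel F \<Longrightarrow> F \<in> borel_measurable borel"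
  by (simp add: bdd_borel_def)

lemma bdd_borel_bound:
  assumes "bdd_borel F"
  obtains C where "0 < C" "\<And>x. \<bar>F x\<bar> \<le> C"
  using assms unfolding bdd_borel_def bounded_pos by auto

lemma bdd_borelI: "F \<in> borel_measurable borel \<Longrightarrow> (\<And>x. \<bar>F x\<bar> \<le> C) \<Longrightarrow> bdd_borel F"
  unfolding bdd_borel_def bounded_iff by auto

lemma smooth_bdd_imp_bdd_borel: "smooth_bdd F \<Longrightarrow> bdd_borel F"
  using continuous_funpow_deriv[of F 0]
  unfolding bdd_borel_def smooth_bdd_def
  by (auto intro: borel_measurable_continuous_onI dest: spec[of _ 0])

lemma smooth_bdd_isCont: "smooth_bdd F \<Longrightarrow> isCont F x"
  using smooth_bdd_has_derivative DERIV_isCont by blast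


section \<open>Convolution with finite measures\<close>

text \<open>Strictly a convolution with the reflected measure. With this sign, \<open>conv\<close>
  by the law of Z is the expectation of F (x + Z), and its value at 0 is that of F (Z).\<close>

definition conv :: "real measure \<Rightarrow> (real \<Rightarrow> real) \<Rightarrow> real \<Rightarrow> real" where
  "conv \<mu> F x = (LINT z|\<mu>. F (x + z))"

locale finite_borel = finite_measure \<mu> for \<mu> :: "real measure" +
  assumes sets_eq [simp, measurable_cong]: "sets \<mu> = sets borel"
begin

lemma integrable_bdd_borel:
  assumes "bdd_borel F"
  shows "integrable \<mu> (\<lambda>z. F (x + z))"
proof -
  obtain C where C: "\<And>x. \<bar>F x\<bar> \<le> C" using bdd_borel_bound[OF assms] by metis
  note [measurable] = bdd_borel_measurable[OF assms]
  show ?thesis by (rule integrable_const_bound[of _ C]) (use C in auto)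
qed

lemma abs_integral_le:
  assumes "bdd_borel F" "\<And>z. \<bar>F (x + z)\<bar> \<le> C"
  shows "\<bar>conv \<mu> F x\<bar> \<le> C * measure \<mu> (space \<mu>)"
proof -
  have "\<bar>conv \<mu> F x\<bar> \<le> (LINT z|\<mu>. \<bar>F (x + z)\<bar>)"
    unfolding conv_def by (rule integral_abs_bound)
  also have "\<dots> \<le> (LINT z|\<mu>. C)"
    using assms(2)
    by (intro integral_mono integrable_abs integrable_bdd_borel[OF assms(1)] integrable_const) auto
  finally show ?thesis by (simp add: mult.commute)
qed

lemma bdd_borel_conv:
  assumes "bdd_borel F"
  shows "bdd_borel (conv \<mu> F)"
proof -
  obtain C where "\<And>x. \<bar>F x\<bar> \<le> C" using bdd_borel_bound[OF assms] by metis
  note [measurable] = bdd_borel_measurable[OF assms]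
  show ?thesis
  proof (rule bdd_borelI)
    show "conv \<mu> F \<in> borel_measurable borel"
      unfolding conv_def by (intro borel_measurable_lebesgue_integral) simp
    show "\<bar>conv \<mu> F x\<bar> \<le> C * measure \<mu> (space \<mu>)" for x
      by (rule abs_integral_le) fact+
  qed
qed

lemma conv_tendsto:
  assumes "\<And>m. bdd_borel (F m)" "\<And>m x. \<bar>F m x\<bar> \<le> C" "\<And>x. (\<lambda>m. F m x) \<longlonglongrightarrow> G x"
  shows "(\<lambda>m. conv \<mu> (F m) x) \<longlonglongrightarrow> conv \<mu> G x"
proof -
  have [measurable]: "F m \<in> borel_measurable borel" for m
    by (rule bdd_borel_measurable[OF assms(1)])
  have [measurable]: "G \<in> borel_measurable borel"
    by (rule borel_measurable_LIMSEQ_real[OF assms(3)]) auto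
  show ?thesis unfolding conv_def
    by (rule integral_dominated_convergence[where w="\<lambda>_. C"]) (use assms in auto)
qed

text \<open>The mean value theorem bounds all difference quotients by the supremum of the
  derivative, a constant that is integrable because the measure is finite. Limits are taken along
  sequences so that dominated convergence applies.\<close>

lemma conv_has_derivative:
  assumes "smooth_bdd F"
  shows "(conv \<mu> F has_real_derivative conv \<mu> (deriv F) x) (at x)"
proof -
  have F': "smooth_bdd (deriv F)" by (rule smooth_bdd_deriv[OF assms])
  obtain B where B: "\<And>x. \<bar>deriv F x\<bar> \<le> B"
    using bdd_borel_bound[OF smooth_bdd_imp_bdd_borel[OF F']] by metis
  have lip: "\<bar>F u - F v\<bar> \<le> B * \<bar>u - v\<bar>" for u v
    using field_differentiable_bound[of UNIV F "deriv F" B u v] smooth_bdd_has_derivative[OF assms] B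
    by (auto simp: real_norm_def)
  note [measurable] = bdd_borel_measurable[OF smooth_bdd_imp_bdd_borel[OF assms]]
    bdd_borel_measurable[OF smooth_bdd_imp_bdd_borel[OF F']]
  have "((\<lambda>h. (conv \<mu> F (x + h) - conv \<mu> F x) / h) \<longlongrightarrow> conv \<mu> (deriv F) x) (at 0)"
    unfolding tendsto_at_iff_sequentially
  proof (intro allI impI)
    fix H :: "nat \<Rightarrow> real" assume H: "\<forall>i. H i \<in> UNIV - {0}" "H \<longlonglongrightarrow> 0"
    have "(\<lambda>i. LINT z|\<mu>. (F (x + H i + z) - F (x + z)) / H i) \<longlonglongrightarrow> (LINT z|\<mu>. deriv F (x + z))"
    proof (rule integral_dominated_convergence[where w="\<lambda>_. B"])
      have "((\<lambda>h. (F (x + h + z) - F (x + z)) / h) \<longlongrightarrow> deriv F (x + z)) (at 0)" for z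
        using smooth_bdd_has_derivative[OF assms, of "x + z"] by (simp add: DERIV_def add_ac)
      then have "(\<lambda>i. (F (x + H i + z) - F (x + z)) / H i) \<longlonglongrightarrow> deriv F (x + z)" for z
        using H unfolding tendsto_at_iff_sequentially by (auto simp: o_def)
      then show "AE z in \<mu>. (\<lambda>i. (F (x + H i + z) - F (x + z)) / H i) \<longlonglongrightarrow> deriv F (x + z)"
        by simp
      show "AE z in \<mu>. norm ((F (x + H i + z) - F (x + z)) / H i) \<le> B" for i
      proof (intro AE_I2)
        fix z
        show "norm ((F (x + H i + z) - F (x + z)) / H i) \<le> B"
          using lip[of "x + H i + z" "x + z"] H(1) by (auto simp: divide_le_eq)
      qed
    qed auto
    moreover have "(conv \<mu> F (x + H i) - conv \<mu> F x) / H i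
      = (LINT z|\<mu>. (F (x + H i + z) - F (x + z)) / H i)" for i
      using integrable_bdd_borel[OF smooth_bdd_imp_bdd_borel[OF assms]]
      by (simp add: conv_def)
    ultimately show "((\<lambda>h. (conv \<mu> F (x + h) - conv \<mu> F x) / h) \<circ> H) \<longlonglongrightarrow> conv \<mu> (deriv F) x"
      by (simp only: conv_def o_def)
  qed
  then show ?thesis by (simp add: DERIV_def)
qed

lemma funpow_deriv_conv:
  assumes "smooth_bdd F"
  shows "(deriv ^^ k) (conv \<mu> F) = conv \<mu> ((deriv ^^ k) F)"
  using funpow_deriv_eqI[of "\<lambda>k. conv \<mu> ((deriv ^^ k) F)" k]
    conv_has_derivative[OF smooth_bdd_funpow_deriv[OF assms]] by simp

lemma smooth_bdd_conv:
  assumes "smooth_bdd F"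
  shows "smooth_bdd (conv \<mu> F)"
  unfolding smooth_bdd_def funpow_deriv_conv[OF assms]
  using smoothI[of "\<lambda>k. conv \<mu> ((deriv ^^ k) F)"]
    conv_has_derivative[OF smooth_bdd_funpow_deriv[OF assms]]
    bdd_borel_conv[OF smooth_bdd_imp_bdd_borel[OF smooth_bdd_funpow_deriv[OF assms]]]
  by (simp add: bdd_borel_def)

lemma bdd_borel_conv_funpow: "bdd_borel F \<Longrightarrow> bdd_borel ((conv \<mu> ^^ k) F)"
  by (induction k) (auto intro: bdd_borel_conv)

lemma smooth_bdd_conv_funpow: "smooth_bdd F \<Longrightarrow> smooth_bdd ((conv \<mu> ^^ k) F)"
  by (induction k) (auto intro: smooth_bdd_conv)

lemma deriv_conv_funpow:
  "smooth_bdd F \<Longrightarrow> (deriv ^^ j) ((conv \<mu> ^^ k) F) = (conv \<mu> ^^ k) ((deriv ^^ j) F)"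
  by (induction k arbitrary: F) (auto simp: funpow_deriv_conv smooth_bdd_conv_funpow)

lemma abs_conv_funpow_le:
  assumes "bdd_borel F" "\<And>x. \<bar>F x\<bar> \<le> C"
  shows "\<bar>(conv \<mu> ^^ k) F x\<bar> \<le> C * measure \<mu> (space \<mu>) ^ k"
  using assms
proof (induction k arbitrary: x)
  case (Suc k)
  show ?case
    using abs_integral_le[of "(conv \<mu> ^^ k) F" x "C * measure \<mu> (space \<mu>) ^ k"] Suc
    by (simp add: bdd_borel_conv_funpow mult_ac)
qed simp

lemma conv_funpow_tendsto:
  assumes "\<And>m. bdd_borel (F m)" "\<And>m x. \<bar>F m x\<bar> \<le> C" "\<And>x. (\<lambda>m. F m x) \<longlonglongrightarrow> G x"
  shows "(\<lambda>m. (conv \<mu> ^^ k) (F m) x) \<longlonglongrightarrow> (conv \<mu> ^^ k) G x"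
proof (induction k arbitrary: x)
  case (Suc k)
  have "(\<lambda>m. conv \<mu> ((conv \<mu> ^^ k) (F m)) x) \<longlonglongrightarrow> conv \<mu> ((conv \<mu> ^^ k) G) x"
    by (rule conv_tendsto[where C="C * measure \<mu> (space \<mu>) ^ k"])
      (use Suc assms in \<open>auto intro: bdd_borel_conv_funpow abs_conv_funpow_le\<close>)
  then show ?case by simp
qed (simp add: assms)

lemma conv_scale: "conv \<mu> (\<lambda>x. r * F x) x = r * conv \<mu> F x"
  by (simp add: conv_def)

lemma conv_funpow_scale: "(conv \<mu> ^^ k) (\<lambda>x. r * F x) = (\<lambda>x. r * (conv \<mu> ^^ k) F x)"
proof (induction k)
  case (Suc k)
  then show ?case by (auto simp: conv_scale)
qed simp

text \<open>Each convolution moves the argument by at most \<epsilon>, so k of them see F only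
  within k \<epsilon> of x. This is how bounds that hold only away from the origin become
  usable.\<close>

lemma abs_conv_funpow_le_local:
  assumes "AE z in \<mu>. \<bar>z\<bar> \<le> \<epsilon>" "bdd_borel F"
    and "\<And>z. \<bar>z - x\<bar> \<le> real k * \<epsilon> \<Longrightarrow> \<bar>F z\<bar> \<le> C" "0 \<le> \<epsilon>"
  shows "\<bar>(conv \<mu> ^^ k) F x\<bar> \<le> C * measure \<mu> (space \<mu>) ^ k"
  using assms
proof (induction k arbitrary: x)
  case (Suc k)
  have "\<bar>(conv \<mu> ^^ k) F (x + z)\<bar> \<le> C * measure \<mu> (space \<mu>) ^ k" if "\<bar>z\<bar> \<le> \<epsilon>" for z
  proof (rule Suc.IH)
    show "\<bar>F u\<bar> \<le> C" if "\<bar>u - (x + z)\<bar> \<le> real k * \<epsilon>" for u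
      using that \<open>\<bar>z\<bar> \<le> \<epsilon>\<close> by (intro Suc.prems(3)) (auto simp: algebra_simps)
  qed (use Suc.prems in auto)
  then have AE: "AE z in \<mu>. norm ((conv \<mu> ^^ k) F (x + z)) \<le> C * measure \<mu> (space \<mu>) ^ k"
    using Suc.prems(1) by auto
  have "norm (conv \<mu> ((conv \<mu> ^^ k) F) x) \<le> (LINT z|\<mu>. norm ((conv \<mu> ^^ k) F (x + z)))"
    unfolding conv_def by (rule integral_norm_bound)
  also have "\<dots> \<le> (LINT z|\<mu>. C * measure \<mu> (space \<mu>) ^ k)"
    using AE by (intro integral_mono_AE integrable_norm integrable_const
      integrable_bdd_borel[OF bdd_borel_conv_funpow[OF Suc.prems(2)]]) auto
  finally show ?case by (simp add: mult_ac)
qed simp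

end

text \<open>Both sides integrate \<open>F (x + z + w)\<close> over the product measure, and a
  bounded function on a finite measure space is within reach of Fubini.\<close>

lemma conv_commute:
  assumes "finite_borel \<mu>" "finite_borel \<eta>" "bdd_borel F"
  shows "conv \<mu> (conv \<eta> F) = conv \<eta> (conv \<mu> F)"
proof
  fix x
  interpret \<mu>: finite_borel \<mu> by fact
  interpret \<eta>: finite_borel \<eta> by fact
  interpret pair_sigma_finite \<mu> \<eta> ..
  interpret P: finite_measure "\<mu> \<Otimes>\<^sub>M \<eta>"
    by (rule finite_measure_pair_measure) unfold_locales
  note [measurable] = bdd_borel_measurable[OF assms(3)]
  obtain C where C: "\<And>x. \<bar>F x\<bar> \<le> C" using bdd_borel_bound[OF assms(3)] by metis
  have "integrable (\<mu> \<Otimes>\<^sub>M \<eta>) (\<lambda>(z, w). F (x + z + w))"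
    by (rule P.integrable_const_bound[of _ C]) (use C in auto)
  from Fubini_integral[OF this]
  show "conv \<mu> (conv \<eta> F) x = conv \<eta> (conv \<mu> F) x"
    by (simp add: conv_def ac_simps)
qed

lemma conv_commute_funpow:
  assumes "finite_borel \<mu>" "finite_borel \<eta>" "bdd_borel F"
  shows "conv \<mu> ((conv \<eta> ^^ k) F) = (conv \<eta> ^^ k) (conv \<mu> F)"
  using assms(3)
  by (induction k arbitrary: F)
     (auto simp: conv_commute[OF assms(1,2)] finite_borel.bdd_borel_conv_funpow[OF assms(2)])

section \<open>Decomposition of the generator\<close>

lemma taylor_integral:
  assumes "smooth_bdd F"
  shows "F (x + u) - F x - u * deriv F x = u\<^sup>2 * (LINT \<beta>|beta_part. deriv (deriv F) (x + \<beta> * u))"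
proof -
  let ?F1 = "deriv F" and ?F2 = "deriv (deriv F)"
  \<comment> \<open>An antiderivative of the remainder integrand: the two first-order terms of its
    derivative cancel, and \<open>?G 1 - ?G 0\<close> is the left-hand side.\<close>
  let ?G = "\<lambda>\<beta>. F (x + \<beta> * u) + (1 - \<beta>) * (u * ?F1 (x + \<beta> * u))"
  let ?g = "\<lambda>\<beta>. (1 - \<beta>) * u\<^sup>2 * ?F2 (x + \<beta> * u)"
  have s1: "smooth_bdd ?F1" and s2: "smooth_bdd ?F2"
    using assms by (auto intro: smooth_bdd_deriv)
  note [measurable] = bdd_borel_measurable[OF smooth_bdd_imp_bdd_borel[OF s2]]
  have line: "((\<lambda>\<beta>. H (x + \<beta> * u)) has_real_derivative deriv H (x + \<beta> * u) * u) (at \<beta>)"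
    if "smooth_bdd H" for H \<beta>
    by (rule DERIV_chain2[OF smooth_bdd_has_derivative[OF that]]) (auto intro!: derivative_eq_intros)
  have "(?G has_real_derivative ?F1 (x + \<beta> * u) * u
      + ((0 - 1) * (u * ?F1 (x + \<beta> * u)) + u * (?F2 (x + \<beta> * u) * u) * (1 - \<beta>))) (at \<beta>)" for \<beta>
    by (intro DERIV_add DERIV_mult DERIV_cmult DERIV_diff DERIV_const DERIV_ident line assms s1)
  then have "(?G has_real_derivative ?g \<beta>) (at \<beta>)" for \<beta>
    by (rule DERIV_cong) (simp add: algebra_simps power2_eq_square)
  then have "(?G has_vector_derivative ?g \<beta>) (at \<beta> within {0..1})" for \<beta>
    by (simp add: has_real_derivative_iff_has_vector_derivative has_vector_derivative_at_within)
  moreover have "continuous_on UNIV ?F2"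
    using smooth_bdd_isCont[OF s2] by (simp add: continuous_on_eq_continuous_at)
  then have "continuous_on {0..1} (\<lambda>\<beta>. ?F2 (x + \<beta> * u))"
    by (rule continuous_on_compose2) (auto intro!: continuous_intros)
  then have "continuous_on {0..1} ?g"
    by (intro continuous_on_mult continuous_on_diff continuous_on_const continuous_on_id)
  ultimately have "has_bochner_integral lborel (\<lambda>\<beta>. indicator {0..1} \<beta> *\<^sub>R ?g \<beta>) (?G 1 - ?G 0)"
    by (intro has_bochner_integral_FTC_Icc) auto
  then have "?G 1 - ?G 0 = (LBINT \<beta>. indicator {0..1} \<beta> *\<^sub>R ?g \<beta>)"
    by (simp add: has_bochner_integral_integral_eq)
  also have "\<dots> = (LBINT \<beta>. u\<^sup>2 * (((1 - \<beta>) * indicator {0..1} \<beta>) *\<^sub>R ?F2 (x + \<beta> * u)))"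
    by (intro Bochner_Integration.integral_cong) (auto simp: mult_ac)
  also have "\<dots> = u\<^sup>2 * (LINT \<beta>|beta_part. ?F2 (x + \<beta> * u))"
    unfolding beta_part_def by (subst integral_density) (auto simp: indicator_def)
  finally show ?thesis by (simp add: algebra_simps)
qed

lemma finite_beta_part: "finite_measure beta_part"
proof
  have "emeasure beta_part (space beta_part) = (\<integral>\<^sup>+\<beta>. ennreal ((1 - \<beta>) * indicator {0..1} \<beta>) \<partial>lborel)"
    by (simp add: beta_part_def emeasure_density)
  also have "\<dots> \<le> (\<integral>\<^sup>+\<beta>. indicator {0..1::real} \<beta> \<partial>lborel)"
    by (intro nn_integral_mono) (auto simp: indicator_def)
  also have "\<dots> < \<infinity>" by simp
  finally show "emeasure beta_part (space beta_part) \<noteq> \<infinity>" by simp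
qed

lemma sets_beta_part [simp, measurable_cong]: "sets beta_part = sets borel"
  by (simp add: beta_part_def)

section \<open>Truncating a Levy measure: integrability and the resulting finite measures\<close>

locale truncated_levy =
  fixes \<epsilon> :: real and c :: "real \<Rightarrow> real" and \<nu> :: "real measure"
  assumes eps: "0 < \<epsilon>" "\<epsilon> < 1"
    and truncation: "truncation \<epsilon> c"
    and levy: "is_levy_measure \<nu>"
begin

lemma sets_nu [simp, measurable_cong]: "sets \<nu> = sets borel"
  using levy by (simp add: is_levy_measure_def)

lemma space_nu [simp]: "space \<nu> = UNIV"
  using sets_eq_imp_space_eq[OF sets_nu] by simp

lemma smooth_c: "smooth c"
  using truncation by (simp add: truncation_def)

lemma c_measurable [measurable]: "c \<in> borel_measurable borel"
  using continuous_funpow_deriv[OF smooth_c, of 0] by (simp add: borel_measurable_continuous_onI)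

lemma c_bounds: "0 \<le> c x" "c x \<le> 1"
  and c_eq_1: "\<bar>x\<bar> \<le> \<epsilon> / 2 \<Longrightarrow> c x = 1"
  and c_eq_0: "\<epsilon> < \<bar>x\<bar> \<Longrightarrow> c x = 0"
proof -
  have *: "indicator {- \<epsilon> / 2..\<epsilon> / 2} x \<le> c x" "c x \<le> indicator {- \<epsilon>..\<epsilon>} x"
    using truncation by (auto simp: truncation_def)
  show "0 \<le> c x" using *(1) by (rule order_trans[rotated]) simp
  show "c x \<le> 1" using *(2) by (rule order_trans) (simp add: indicator_def)
  then show "c x = 1" if "\<bar>x\<bar> \<le> \<epsilon> / 2"
  proof -
    from that have "x \<in> {- \<epsilon> / 2..\<epsilon> / 2}" by auto
    with *(1) \<open>c x \<le> 1\<close> show ?thesis by simp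
  qed
  show "c x = 0" if "\<epsilon> < \<bar>x\<bar>"
  proof -
    from that have "x \<notin> {- \<epsilon>..\<epsilon>}" by auto
    with *(2) \<open>0 \<le> c x\<close> show ?thesis by simp
  qed
qed

text \<open>Domination by min 1 (x^2) is the form in which the Levy condition controls integrals, so
  the integrability statements about \<nu> below reduce to a pointwise estimate.\<close>

lemma integrable_levyI:
  assumes [measurable]: "f \<in> borel_measurable borel" and "\<And>x. \<bar>f x\<bar> \<le> C * min 1 (x\<^sup>2)"
  shows "integrable \<nu> f"
proof (rule Bochner_Integration.integrable_bound)
  show "integrable \<nu> (\<lambda>x. C * min 1 (x\<^sup>2))"
    using levy by (intro integrable_mult_right integrableI_nonneg) (auto simp: is_levy_measure_def)
  show "AE x in \<nu>. norm (f x) \<le> norm (C * min 1 (x\<^sup>2))"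
    using assms(2) by (intro AE_I2) (metis abs_ge_self order_trans real_norm_def)
qed auto

text \<open>The constant serves both branches of the minimum: beyond \<epsilon>/2 one has 4 x^2 /
  \<epsilon>^2 \<ge> 1, and 4 / \<epsilon>^2 \<ge> 1 since \<epsilon> < 1.\<close>

lemma indicator_large_le: "(if \<epsilon> / 2 < \<bar>x\<bar> then 1 else 0) \<le> 4 / \<epsilon>\<^sup>2 * min 1 (x\<^sup>2)"
proof -
  have "\<epsilon>\<^sup>2 \<le> 1" using eps by (simp add: power_le_one)
  moreover have "\<epsilon>\<^sup>2 \<le> 4 * x\<^sup>2" if "\<epsilon> / 2 < \<bar>x\<bar>"
    using power_mono[of "\<epsilon>" "2 * \<bar>x\<bar>" 2] that eps by (simp add: power_mult_distrib)
  ultimately show ?thesis using eps by (auto simp: field_simps min_def)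
qed

lemma cbar_le: "1 - c x \<le> 4 / \<epsilon>\<^sup>2 * min 1 (x\<^sup>2)"
  using indicator_large_le[of x] c_bounds[of x] c_eq_1[of x] by (auto split: if_splits)

lemma c_sq_le: "c x * x\<^sup>2 \<le> min 1 (x\<^sup>2)"
proof (cases "\<bar>x\<bar> \<le> \<epsilon>")
  case True
  then have "x\<^sup>2 \<le> 1" using eps by (simp add: abs_square_le_1)
  then show ?thesis using c_bounds[of x] by (simp add: mult_left_le_one_le)
qed (use c_eq_0[of x] in auto)

lemma integrable_cbar: "integrable \<nu> (\<lambda>x. 1 - c x)"
  by (rule integrable_levyI[where C="4 / \<epsilon>\<^sup>2"]) (use cbar_le c_bounds in auto)

lemma integrable_c_sq: "integrable \<nu> (\<lambda>x. c x * x\<^sup>2)"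
  by (rule integrable_levyI[where C=1]) (use c_sq_le c_bounds in auto)

text \<open>The integrand vanishes for |u| \<le> \<epsilon>/2, where indicator and c are both 1, and
  for |u| > 1, where both are 0; in between its modulus is at most 1.\<close>

lemma integrable_drift: "integrable \<nu> (\<lambda>u. u * (indicator {u. \<bar>u\<bar> \<le> 1} u - c u))"
proof (rule integrable_levyI[where C="4 / \<epsilon>\<^sup>2"])
  show "\<bar>u * (indicator {u. \<bar>u\<bar> \<le> 1} u - c u)\<bar> \<le> 4 / \<epsilon>\<^sup>2 * min 1 (u\<^sup>2)" for u
  proof -
    have "\<bar>u * (indicator {u. \<bar>u\<bar> \<le> 1} u - c u)\<bar> \<le> (if \<epsilon> / 2 < \<bar>u\<bar> then 1 else 0)"
      using c_bounds[of u] c_eq_1[of u] c_eq_0[of u] eps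
      by (auto simp: indicator_def abs_mult intro!: mult_le_one)
    with indicator_large_le[of u] show ?thesis by linarith
  qed
qed measurable

sublocale big: finite_borel "big_part c \<nu>"
proof (intro finite_borel.intro finite_borel_axioms.intro finite_measureI)
  have "emeasure (big_part c \<nu>) (space (big_part c \<nu>)) = (\<integral>\<^sup>+x. ennreal (1 - c x) \<partial>\<nu>)"
    by (simp add: big_part_def emeasure_density)
  also have "\<dots> < \<infinity>"
    using integrable_cbar c_bounds by (subst nn_integral_eq_integral) auto
  finally show "emeasure (big_part c \<nu>) (space (big_part c \<nu>)) \<noteq> \<infinity>" by simp
qed (simp add: big_part_def)

sublocale small: finite_borel "small_part c \<nu>"
proof (intro finite_borel.intro finite_borel_axioms.intro finite_measureI)
  have "emeasure (small_part c \<nu>) (space (small_part c \<nu>)) = (\<integral>\<^sup>+x. ennreal (c x * x\<^sup>2) \<partial>\<nu>)"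
    by (simp add: small_part_def emeasure_density)
  also have "\<dots> < \<infinity>"
    using integrable_c_sq c_bounds by (subst nn_integral_eq_integral) auto
  finally show "emeasure (small_part c \<nu>) (space (small_part c \<nu>)) \<noteq> \<infinity>" by simp
qed (simp add: small_part_def)

sublocale beta: finite_measure beta_part
  by (rule finite_beta_part)

sublocale small_beta: pair_sigma_finite "small_part c \<nu>" beta_part ..

text \<open>The push-forward merges the two integrations of the Taylor remainder into one, so that K
  is a plain convolution and shares all commutation and iteration lemmas with S.\<close>

definition kappa :: "real measure" where
  "kappa = distr (small_part c \<nu> \<Otimes>\<^sub>M beta_part) borel (\<lambda>(w, \<beta>). \<beta> * w)"

sublocale small_beta_finite: finite_measure "small_part c \<nu> \<Otimes>\<^sub>M beta_part"
  by (rule finite_measure_pair_measure) unfold_locales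

sublocale kappa: finite_borel kappa
proof (intro finite_borel.intro finite_borel_axioms.intro)
  show "finite_measure kappa"
    unfolding kappa_def by (rule small_beta_finite.finite_measure_distr) measurable
qed (simp add: kappa_def)

lemma conv_kappa:
  assumes "bdd_borel F"
  shows "conv kappa F x = (LINT w|small_part c \<nu>. LINT \<beta>|beta_part. F (x + \<beta> * w))"
proof -
  note [measurable] = bdd_borel_measurable[OF assms]
  obtain C where C: "\<And>x. \<bar>F x\<bar> \<le> C" using bdd_borel_bound[OF assms] by metis
  have "integrable (small_part c \<nu> \<Otimes>\<^sub>M beta_part) (\<lambda>(w, \<beta>). F (x + \<beta> * w))"
    by (rule small_beta_finite.integrable_const_bound[of _ C]) (use C in auto)
  from small_beta.integral_fst'[OF this] show ?thesis
    unfolding conv_def kappa_def by (subst integral_distr) (auto simp: case_prod_unfold)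
qed

text \<open>The weight of w vanishes beyond \<epsilon> because c does, and \<beta> ranges over
  [0, 1].\<close>

lemma kappa_support: "AE z in kappa. \<bar>z\<bar> \<le> \<epsilon>"
proof -
  have w: "AE w in small_part c \<nu>. \<bar>w\<bar> \<le> \<epsilon>"
    unfolding small_part_def using c_eq_0 not_less by (subst AE_density) (auto, fastforce)
  have \<beta>: "AE \<beta> in beta_part. \<bar>\<beta>\<bar> \<le> 1"
    unfolding beta_part_def by (subst AE_density) (auto intro!: AE_I2 simp: indicator_def)
  have "AE w in small_part c \<nu>. AE \<beta> in beta_part. \<bar>\<beta> * w\<bar> \<le> \<epsilon>"
    using w
  proof eventually_elim
    case (elim w)
    from \<beta> show ?case
    proof eventually_elim
      case (elim \<beta>)
      then show ?case
        using mult_mono[of "\<bar>\<beta>\<bar>" 1 "\<bar>w\<bar>" \<epsilon>] \<open>\<bar>w\<bar> \<le> \<epsilon>\<close> by (simp add: abs_mult)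
    qed
  qed
  moreover have "{q \<in> space (small_part c \<nu> \<Otimes>\<^sub>M beta_part). \<bar>snd q * fst q\<bar> \<le> \<epsilon>}
    \<in> sets (small_part c \<nu> \<Otimes>\<^sub>M beta_part)"
    by measurable
  ultimately have "AE q in small_part c \<nu> \<Otimes>\<^sub>M beta_part. \<bar>snd q * fst q\<bar> \<le> \<epsilon>"
    by (intro small_beta.AE_pair_measure) simp_all
  then show ?thesis
    unfolding kappa_def by (subst AE_distr_iff) (auto simp: split_beta)
qed

text \<open>Multiplying the jump integrand by 1 = (1 - c) + c separates the jumps. Large ones need
  no compensation, small ones are compensated by c u F' and leave a Taylor remainder, and the
  discrepancy between the compensators c and \<open>indicator {u. \<bar>u\<bar> \<le> 1}\<close> is
  the correction of the drift in \<open>b1\<close>.\<close>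

lemma levy_generator_decomp:
  assumes "smooth_bdd F"
  shows "levy_generator \<sigma> b \<nu> F x = b0 c \<nu> * F x + b1 b c \<nu> * deriv F x + b2 \<sigma> * deriv (deriv F) x
    + conv (big_part c \<nu>) F x + conv kappa (deriv (deriv F)) x"
proof -
  let ?F2 = "deriv (deriv F)"
  have s2: "smooth_bdd ?F2" by (intro smooth_bdd_deriv assms)
  obtain C where C: "\<And>x. \<bar>F x\<bar> \<le> C"
    using bdd_borel_bound[OF smooth_bdd_imp_bdd_borel[OF assms]] by metis
  obtain C2 where C2: "\<And>x. \<bar>?F2 x\<bar> \<le> C2" "0 < C2"
    using bdd_borel_bound[OF smooth_bdd_imp_bdd_borel[OF s2]] by metis
  note [measurable] = bdd_borel_measurable[OF smooth_bdd_imp_bdd_borel[OF assms]]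
    bdd_borel_measurable[OF smooth_bdd_imp_bdd_borel[OF s2]]
  \<comment> \<open>The Taylor remainder divided by u^2, in integral form so that it stays defined
    and bounded at u = 0.\<close>
  define R where "R u = (LINT \<beta>|beta_part. ?F2 (x + \<beta> * u))" for u
  have R [measurable]: "R \<in> borel_measurable borel"
    unfolding R_def by (intro beta.borel_measurable_lebesgue_integral) measurable
  have R_bound: "\<bar>R u\<bar> \<le> C2 * measure beta_part (space beta_part)" for u
  proof -
    have i: "integrable beta_part (\<lambda>\<beta>. ?F2 (x + \<beta> * u))"
      by (rule beta.integrable_const_bound[of _ C2]) (use C2 in auto)
    have "\<bar>R u\<bar> \<le> (LINT \<beta>|beta_part. \<bar>?F2 (x + \<beta> * u)\<bar>)"
      unfolding R_def by (rule integral_abs_bound)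
    also have "\<dots> \<le> (LINT \<beta>|beta_part. C2)"
      using C2 i by (intro integral_mono integrable_abs) auto
    finally show ?thesis by (simp add: mult.commute)
  qed
  have iA: "integrable \<nu> (\<lambda>u. (1 - c u) * F (x + u))"
  proof (rule integrable_levyI[where C="C * (4 / \<epsilon>\<^sup>2)"])
    show "\<bar>(1 - c u) * F (x + u)\<bar> \<le> C * (4 / \<epsilon>\<^sup>2) * min 1 (u\<^sup>2)" for u
      using mult_mono[OF C[of "x + u"] cbar_le[of u]] C[of 0] c_bounds[of u]
      by (auto simp: abs_mult mult_ac)
  qed measurable
  have iB: "integrable \<nu> (\<lambda>u. c u * u\<^sup>2 * R u)"
  proof (rule integrable_levyI[where C="C2 * measure beta_part (space beta_part)"])
    show "\<bar>c u * u\<^sup>2 * R u\<bar> \<le> C2 * measure beta_part (space beta_part) * min 1 (u\<^sup>2)" for u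
      using mult_mono[OF R_bound[of u] c_sq_le[of u]] C2(2) c_bounds[of u]
      by (auto simp: abs_mult mult_ac)
  qed measurable
  \<comment> \<open>The grouping is chosen so that each of the four summands is integrable on its
    own; this permits splitting the integral.\<close>
  have "(LINT u|\<nu>. F (u + x) - F x - u * deriv F x * indicator {u. \<bar>u\<bar> \<le> 1} u)
    = (LINT u|\<nu>. ((1 - c u) * F (x + u) - F x * (1 - c u)
        - deriv F x * (u * (indicator {u. \<bar>u\<bar> \<le> 1} u - c u))) + c u * u\<^sup>2 * R u)"
  proof (intro Bochner_Integration.integral_cong refl)
    fix u
    have "c u * (u\<^sup>2 * R u) = c u * (F (x + u) - F x - u * deriv F x)"
      unfolding R_def taylor_integral[OF assms, symmetric] ..
    then show "F (u + x) - F x - u * deriv F x * indicator {u. \<bar>u\<bar> \<le> 1} u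
      = ((1 - c u) * F (x + u) - F x * (1 - c u)
        - deriv F x * (u * (indicator {u. \<bar>u\<bar> \<le> 1} u - c u))) + c u * u\<^sup>2 * R u"
      by (simp add: algebra_simps)
  qed
  also have "\<dots> = (LINT u|\<nu>. (1 - c u) * F (x + u)) - F x * (LINT u|\<nu>. 1 - c u)
      - deriv F x * (LINT u|\<nu>. u * (indicator {u. \<bar>u\<bar> \<le> 1} u - c u)) + (LINT u|\<nu>. c u * u\<^sup>2 * R u)"
    using iA iB integrable_cbar integrable_drift by simp
  also have "(LINT u|\<nu>. (1 - c u) * F (x + u)) = conv (big_part c \<nu>) F x"
    unfolding conv_def big_part_def by (subst integral_density) (use c_bounds in auto)
  also have "(LINT u|\<nu>. c u * u\<^sup>2 * R u) = conv kappa ?F2 x"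
    unfolding conv_kappa[OF smooth_bdd_imp_bdd_borel[OF s2]] R_def[symmetric] small_part_def
    by (subst integral_density) (use c_bounds in auto)
  finally show ?thesis
    unfolding levy_generator_def b0_def b1_def b2_def by (simp add: algebra_simps)
qed

end

section \<open>Iterates of the generator\<close>

lemma finite_idx_set [simp]: "finite (idx_set N)"
proof (rule finite_subset)
  show "idx_set N \<subseteq> {..N} \<times> {..N} \<times> {..N} \<times> {..N} \<times> {..N}"
    by (auto simp: idx_set_def)
qed auto

lemma idx_set_0: "idx_set 0 = {(0, 0, 0, 0, 0)}"
  by (auto simp: idx_set_def)

lemma multinom_Suc:
  fixes k0 k1 k2 k3 k4 :: nat
  defines "m \<equiv> multinom (k0, k1, k2, k3, k4)" and "r \<equiv> real (Suc (k0 + k1 + k2 + k3 + k4))"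
  shows "r * m = real (Suc k0) * multinom (Suc k0, k1, k2, k3, k4)"
    and "r * m = real (Suc k1) * multinom (k0, Suc k1, k2, k3, k4)"
    and "r * m = real (Suc k2) * multinom (k0, k1, Suc k2, k3, k4)"
    and "r * m = real (Suc k3) * multinom (k0, k1, k2, Suc k3, k4)"
    and "r * m = real (Suc k4) * multinom (k0, k1, k2, k3, Suc k4)"
  unfolding m_def r_def by (simp_all add: divide_simps del: of_nat_Suc of_nat_add)

text \<open>Pascal's rule, from \<open>k\<^sub>i multinom k = (N + 1) multinom (k - e\<^sub>i)\<close> summed over \<open>i\<close>.\<close>

lemma sum_multinom_Suc:
  fixes H :: "idx \<Rightarrow> real"
  shows "(\<Sum>k\<in>idx_set (Suc N). multinom k * H k) =
    (\<Sum>(k0, k1, k2, k3, k4)\<in>idx_set N. multinom (k0, k1, k2, k3, k4) *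
      (H (Suc k0, k1, k2, k3, k4) + H (k0, Suc k1, k2, k3, k4) + H (k0, k1, Suc k2, k3, k4)
       + H (k0, k1, k2, Suc k3, k4) + H (k0, k1, k2, k3, Suc k4)))"
proof -
  let ?w = "\<lambda>k. multinom k * H k"
  have fin: "finite {(k0, k1, k2, k3, k4) \<in> idx_set (Suc N). P k0 k1 k2 k3 k4}" for P
    by (rule finite_subset[OF _ finite_idx_set[of "Suc N"]]) auto
  have r0: "multinom (k0, k1, k2, k3, k4) = real (Suc k0) / real (Suc N) * multinom (Suc k0, k1, k2, k3, k4)"
    if "k0 + k1 + k2 + k3 + k4 = N" for k0 k1 k2 k3 k4
    using multinom_Suc(1)[of k0 k1 k2 k3 k4] unfolding that
    by (simp add: field_simps del: of_nat_Suc multinom.simps)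
  have r1: "multinom (k0, k1, k2, k3, k4) = real (Suc k1) / real (Suc N) * multinom (k0, Suc k1, k2, k3, k4)"
    if "k0 + k1 + k2 + k3 + k4 = N" for k0 k1 k2 k3 k4
    using multinom_Suc(2)[of k0 k1 k2 k3 k4] unfolding that
    by (simp add: field_simps del: of_nat_Suc multinom.simps)
  have r2: "multinom (k0, k1, k2, k3, k4) = real (Suc k2) / real (Suc N) * multinom (k0, k1, Suc k2, k3, k4)"
    if "k0 + k1 + k2 + k3 + k4 = N" for k0 k1 k2 k3 k4
    using multinom_Suc(3)[of k0 k1 k2 k3 k4] unfolding that
    by (simp add: field_simps del: of_nat_Suc multinom.simps)
  have r3: "multinom (k0, k1, k2, k3, k4) = real (Suc k3) / real (Suc N) * multinom (k0, k1, k2, Suc k3, k4)"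
    if "k0 + k1 + k2 + k3 + k4 = N" for k0 k1 k2 k3 k4
    using multinom_Suc(4)[of k0 k1 k2 k3 k4] unfolding that
    by (simp add: field_simps del: of_nat_Suc multinom.simps)
  have r4: "multinom (k0, k1, k2, k3, k4) = real (Suc k4) / real (Suc N) * multinom (k0, k1, k2, k3, Suc k4)"
    if "k0 + k1 + k2 + k3 + k4 = N" for k0 k1 k2 k3 k4
    using multinom_Suc(5)[of k0 k1 k2 k3 k4] unfolding that
    by (simp add: field_simps del: of_nat_Suc multinom.simps)
  \<comment> \<open>Raising \<open>k0\<close> hits every index of total N + 1 except those with k0 =
    0, which form \<open>T'\<close> and carry weight 0 on the right. The four analogues treat the
    other entries.\<close>
  have 0: "(\<Sum>(k0, k1, k2, k3, k4)\<in>idx_set N. multinom (k0, k1, k2, k3, k4) * H (Suc k0, k1, k2, k3, k4))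
    = (\<Sum>(k0, k1, k2, k3, k4)\<in>idx_set (Suc N). real k0 / real (Suc N) * ?w (k0, k1, k2, k3, k4))"
    by (rule sum.reindex_bij_witness_not_neutral[where S'="{}" and T'="{(k0, k1, k2, k3, k4)\<in>idx_set (Suc N). k0 = 0}"
          and i="\<lambda>(k0, k1, k2, k3, k4). (k0 - 1, k1, k2, k3, k4)" and j="\<lambda>(k0, k1, k2, k3, k4). (Suc k0, k1, k2, k3, k4)"])
      (simp, rule fin, auto simp: idx_set_def r0 simp del: multinom.simps of_nat_Suc)
  have 1: "(\<Sum>(k0, k1, k2, k3, k4)\<in>idx_set N. multinom (k0, k1, k2, k3, k4) * H (k0, Suc k1, k2, k3, k4))
    = (\<Sum>(k0, k1, k2, k3, k4)\<in>idx_set (Suc N). real k1 / real (Suc N) * ?w (k0, k1, k2, k3, k4))"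
    by (rule sum.reindex_bij_witness_not_neutral[where S'="{}" and T'="{(k0, k1, k2, k3, k4)\<in>idx_set (Suc N). k1 = 0}"
          and i="\<lambda>(k0, k1, k2, k3, k4). (k0, k1 - 1, k2, k3, k4)" and j="\<lambda>(k0, k1, k2, k3, k4). (k0, Suc k1, k2, k3, k4)"])
      (simp, rule fin, auto simp: idx_set_def r1 simp del: multinom.simps of_nat_Suc)
  have 2: "(\<Sum>(k0, k1, k2, k3, k4)\<in>idx_set N. multinom (k0, k1, k2, k3, k4) * H (k0, k1, Suc k2, k3, k4))
    = (\<Sum>(k0, k1, k2, k3, k4)\<in>idx_set (Suc N). real k2 / real (Suc N) * ?w (k0, k1, k2, k3, k4))"
    by (rule sum.reindex_bij_witness_not_neutral[where S'="{}" and T'="{(k0, k1, k2, k3, k4)\<in>idx_set (Suc N). k2 = 0}"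
          and i="\<lambda>(k0, k1, k2, k3, k4). (k0, k1, k2 - 1, k3, k4)" and j="\<lambda>(k0, k1, k2, k3, k4). (k0, k1, Suc k2, k3, k4)"])
      (simp, rule fin, auto simp: idx_set_def r2 simp del: multinom.simps of_nat_Suc)
  have 3: "(\<Sum>(k0, k1, k2, k3, k4)\<in>idx_set N. multinom (k0, k1, k2, k3, k4) * H (k0, k1, k2, Suc k3, k4))
    = (\<Sum>(k0, k1, k2, k3, k4)\<in>idx_set (Suc N). real k3 / real (Suc N) * ?w (k0, k1, k2, k3, k4))"
    by (rule sum.reindex_bij_witness_not_neutral[where S'="{}" and T'="{(k0, k1, k2, k3, k4)\<in>idx_set (Suc N). k3 = 0}"
          and i="\<lambda>(k0, k1, k2, k3, k4). (k0, k1, k2, k3 - 1, k4)" and j="\<lambda>(k0, k1, k2, k3, k4). (k0, k1, k2, Suc k3, k4)"])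
      (simp, rule fin, auto simp: idx_set_def r3 simp del: multinom.simps of_nat_Suc)
  have 4: "(\<Sum>(k0, k1, k2, k3, k4)\<in>idx_set N. multinom (k0, k1, k2, k3, k4) * H (k0, k1, k2, k3, Suc k4))
    = (\<Sum>(k0, k1, k2, k3, k4)\<in>idx_set (Suc N). real k4 / real (Suc N) * ?w (k0, k1, k2, k3, k4))"
    by (rule sum.reindex_bij_witness_not_neutral[where S'="{}" and T'="{(k0, k1, k2, k3, k4)\<in>idx_set (Suc N). k4 = 0}"
          and i="\<lambda>(k0, k1, k2, k3, k4). (k0, k1, k2, k3, k4 - 1)" and j="\<lambda>(k0, k1, k2, k3, k4). (k0, k1, k2, k3, Suc k4)"])
      (simp, rule fin, auto simp: idx_set_def r4 simp del: multinom.simps of_nat_Suc)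
  have "(\<Sum>k\<in>idx_set (Suc N). multinom k * H k) = (\<Sum>(k0, k1, k2, k3, k4)\<in>idx_set (Suc N).
      real k0 / real (Suc N) * ?w (k0, k1, k2, k3, k4) + real k1 / real (Suc N) * ?w (k0, k1, k2, k3, k4)
    + real k2 / real (Suc N) * ?w (k0, k1, k2, k3, k4) + real k3 / real (Suc N) * ?w (k0, k1, k2, k3, k4)
    + real k4 / real (Suc N) * ?w (k0, k1, k2, k3, k4))"
  proof (intro sum.cong refl)
    fix k assume k: "k \<in> idx_set (Suc N)"
    obtain k0 k1 k2 k3 k4 where k_eq: "k = (k0, k1, k2, k3, k4)" by (cases k)
    \<comment> \<open>The five weights k_i / (N + 1) add up to 1, so they distribute each summand
      over the five reindexed sums.\<close>
    have "real k0 / real (Suc N) + real k1 / real (Suc N) + real k2 / real (Suc N)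
      + real k3 / real (Suc N) + real k4 / real (Suc N) = real (k0 + k1 + k2 + k3 + k4) / real (Suc N)"
      by (simp only: add_divide_distrib of_nat_add)
    also have "\<dots> = 1" using k by (simp add: k_eq idx_set_def del: of_nat_Suc)
    finally have one: "real k0 / real (Suc N) + real k1 / real (Suc N) + real k2 / real (Suc N)
      + real k3 / real (Suc N) + real k4 / real (Suc N) = 1" .
    show "multinom k * H k = (case k of (k0, k1, k2, k3, k4) \<Rightarrow>
      real k0 / real (Suc N) * ?w (k0, k1, k2, k3, k4) + real k1 / real (Suc N) * ?w (k0, k1, k2, k3, k4)
    + real k2 / real (Suc N) * ?w (k0, k1, k2, k3, k4) + real k3 / real (Suc N) * ?w (k0, k1, k2, k3, k4)
    + real k4 / real (Suc N) * ?w (k0, k1, k2, k3, k4))"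
      unfolding k_eq prod.case distrib_right[symmetric] one by simp
  qed
  also have "\<dots> = (\<Sum>(k0, k1, k2, k3, k4)\<in>idx_set N. multinom (k0, k1, k2, k3, k4) *
      (H (Suc k0, k1, k2, k3, k4) + H (k0, Suc k1, k2, k3, k4) + H (k0, k1, Suc k2, k3, k4)
       + H (k0, k1, k2, Suc k3, k4) + H (k0, k1, k2, k3, Suc k4)))"
    unfolding distrib_left using 0 1 2 3 4
    by (simp add: case_prod_unfold sum.distrib del: multinom.simps)
  finally show ?thesis .
qed

lemma
  assumes "\<And>k. k \<in> A \<Longrightarrow> smooth_bdd (g k)"
  shows smooth_bdd_sum: "smooth_bdd (\<lambda>x. \<Sum>k\<in>A. a k * g k x)"
    and funpow_deriv_sum: "(deriv ^^ j) (\<lambda>x. \<Sum>k\<in>A. a k * g k x) = (\<lambda>x. \<Sum>k\<in>A. a k * (deriv ^^ j) (g k) x)"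
proof -
  let ?F = "\<lambda>j x. \<Sum>k\<in>A. a k * (deriv ^^ j) (g k) x"
  have D: "(?F j has_real_derivative ?F (Suc j) x) (at x)" for j x
    using assms by (intro DERIV_sum DERIV_cmult has_real_derivative_funpow_deriv smooth_bdd_smooth)
  have eq: "(deriv ^^ j) (?F 0) = ?F j" for j
    by (rule funpow_deriv_eqI) (rule D)
  then show "(deriv ^^ j) (\<lambda>x. \<Sum>k\<in>A. a k * g k x) = ?F j" by simp
  have "bounded (range (?F j))" for j
  proof -
    have "\<forall>k. \<exists>C. k \<in> A \<longrightarrow> (\<forall>x. \<bar>(deriv ^^ j) (g k) x\<bar> \<le> C)"
      using assms by (auto simp: smooth_bdd_def bounded_iff)
    then obtain C where C: "\<And>k x. k \<in> A \<Longrightarrow> \<bar>(deriv ^^ j) (g k) x\<bar> \<le> C k" by metis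
    have "\<bar>?F j x\<bar> \<le> (\<Sum>k\<in>A. \<bar>a k\<bar> * C k)" for x
      using C by (intro order_trans[OF sum_abs] sum_mono) (auto simp: abs_mult intro: mult_left_mono)
    then show ?thesis unfolding bounded_iff by auto
  qed
  then show "smooth_bdd (\<lambda>x. \<Sum>k\<in>A. a k * g k x)"
    using smoothI[of ?F, OF D] eq by (simp add: smooth_bdd_def)
qed

lemma (in finite_borel) conv_sum:
  assumes "\<And>k. k \<in> A \<Longrightarrow> bdd_borel (g k)"
  shows "conv \<mu> (\<lambda>x. \<Sum>k\<in>A. a k * g k x) x = (\<Sum>k\<in>A. a k * conv \<mu> (g k) x)"
  unfolding conv_def
  by (subst Bochner_Integration.integral_sum) (use assms integrable_bdd_borel in auto)

context truncated_levy
begin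

text \<open>The normal form into which commutation brings any word in the operators; the scalar
  factors are collected separately.\<close>

fun expansion_term :: "(real \<Rightarrow> real) \<Rightarrow> idx \<Rightarrow> real \<Rightarrow> real" where
  "expansion_term F (k0, k1, k2, k3, k4) =
     (conv (big_part c \<nu>) ^^ k3) ((conv kappa ^^ k4) ((deriv ^^ ell (k0, k1, k2, k3, k4)) F))"

lemma smooth_bdd_expansion_term: "smooth_bdd F \<Longrightarrow> smooth_bdd (expansion_term F k)"
  by (cases k) (auto intro!: big.smooth_bdd_conv_funpow kappa.smooth_bdd_conv_funpow smooth_bdd_funpow_deriv)

text \<open>Linearity is read off the decomposition, whose parts are derivatives and convolutions
  with finite measures; the compensated jump integrand itself need not be handled again.\<close>

lemma levy_generator_sum:
  assumes "\<And>k. k \<in> A \<Longrightarrow> smooth_bdd (g k)"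
  shows "levy_generator \<sigma> b \<nu> (\<lambda>x. \<Sum>k\<in>A. a k * g k x) = (\<lambda>x. \<Sum>k\<in>A. a k * levy_generator \<sigma> b \<nu> (g k) x)"
proof
  fix x
  note [simp] = levy_generator_decomp[OF smooth_bdd_sum[OF assms]]
  have D1: "deriv (\<lambda>x. \<Sum>k\<in>A. a k * g k x) = (\<lambda>x. \<Sum>k\<in>A. a k * deriv (g k) x)"
    using funpow_deriv_sum[OF assms, where j=1 and a=a] by simp
  have D2: "deriv (\<lambda>x. \<Sum>k\<in>A. a k * deriv (g k) x) = (\<lambda>x. \<Sum>k\<in>A. a k * deriv (deriv (g k)) x)"
    using funpow_deriv_sum[of A "\<lambda>k. deriv (g k)" 1 a] assms by (simp add: smooth_bdd_deriv)
  have "levy_generator \<sigma> b \<nu> (\<lambda>x. \<Sum>k\<in>A. a k * g k x) x =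
    b0 c \<nu> * (\<Sum>k\<in>A. a k * g k x) + b1 b c \<nu> * (\<Sum>k\<in>A. a k * deriv (g k) x)
    + b2 \<sigma> * (\<Sum>k\<in>A. a k * deriv (deriv (g k)) x)
    + (\<Sum>k\<in>A. a k * conv (big_part c \<nu>) (g k) x) + (\<Sum>k\<in>A. a k * conv kappa (deriv (deriv (g k))) x)"
    using assms
    by (simp add: D1 D2 big.conv_sum kappa.conv_sum smooth_bdd_deriv smooth_bdd_imp_bdd_borel)
  also have "\<dots> = (\<Sum>k\<in>A. a k * levy_generator \<sigma> b \<nu> (g k) x)"
    using assms by (simp add: levy_generator_decomp sum_distrib_left flip: sum.distrib) (simp add: algebra_simps)
  finally show "levy_generator \<sigma> b \<nu> (\<lambda>x. \<Sum>k\<in>A. a k * g k x) x = (\<Sum>k\<in>A. a k * levy_generator \<sigma> b \<nu> (g k) x)" .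
qed

text \<open>Since derivatives pass through convolutions, each of the five parts of the generator
  raises one index by one. Only K needs an extra commutation, past the powers of S that stand
  outside it.\<close>

lemma levy_generator_expansion_term:
  assumes "smooth_bdd F"
  shows "levy_generator \<sigma> b \<nu> (expansion_term F (k0, k1, k2, k3, k4)) x =
    b0 c \<nu> * expansion_term F (Suc k0, k1, k2, k3, k4) x
    + b1 b c \<nu> * expansion_term F (k0, Suc k1, k2, k3, k4) x
    + b2 \<sigma> * expansion_term F (k0, k1, Suc k2, k3, k4) x
    + expansion_term F (k0, k1, k2, Suc k3, k4) x + expansion_term F (k0, k1, k2, k3, Suc k4) x"
proof -
  let ?k = "(k0, k1, k2, k3, k4)"
  have D: "(deriv ^^ j) (expansion_term F ?k)
    = (conv (big_part c \<nu>) ^^ k3) ((conv kappa ^^ k4) ((deriv ^^ (j + ell ?k)) F))" for j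
    using assms
    by (simp add: big.deriv_conv_funpow kappa.deriv_conv_funpow kappa.smooth_bdd_conv_funpow
        smooth_bdd_funpow_deriv funpow_add)
  have D1: "deriv (expansion_term F ?k) = expansion_term F (k0, Suc k1, k2, k3, k4)"
    using D[of 1] by simp
  have D2: "deriv (deriv (expansion_term F ?k)) = expansion_term F (k0, k1, Suc k2, k3, k4)"
    using D[of 2] by (simp add: numeral_2_eq_2)
  have "conv kappa (deriv (deriv (expansion_term F ?k))) = expansion_term F (k0, k1, k2, k3, Suc k4)"
    unfolding D2 using assms
    by (simp add: conv_commute_funpow[OF kappa.finite_borel_axioms big.finite_borel_axioms]
        kappa.bdd_borel_conv_funpow smooth_bdd_imp_bdd_borel smooth_bdd_funpow_deriv
        smooth_bdd_deriv)
  then show ?thesis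
    unfolding levy_generator_decomp[OF smooth_bdd_expansion_term[OF assms]] D1[symmetric] D2[symmetric]
    by simp
qed

text \<open>The one-index-at-a-time action of the generator is the recursion satisfied by
  multinomial sums in \<open>sum_multinom_Suc\<close>.\<close>

lemma levy_generator_funpow:
  assumes "smooth_bdd F"
  shows "(levy_generator \<sigma> b \<nu> ^^ N) F = (\<lambda>x. \<Sum>k\<in>idx_set N. multinom k *
    ((case k of (k0, k1, k2, k3, k4) \<Rightarrow> b0 c \<nu> ^ k0 * b1 b c \<nu> ^ k1 * b2 \<sigma> ^ k2) * expansion_term F k x))"
proof (induction N)
  case 0
  then show ?case by (simp add: idx_set_0)
next
  case (Suc N)
  let ?b = "\<lambda>k :: idx. case k of (k0, k1, k2, k3, k4) \<Rightarrow> b0 c \<nu> ^ k0 * b1 b c \<nu> ^ k1 * b2 \<sigma> ^ k2"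
  have "(levy_generator \<sigma> b \<nu> ^^ Suc N) F =
    levy_generator \<sigma> b \<nu> (\<lambda>x. \<Sum>k\<in>idx_set N. (multinom k * ?b k) * expansion_term F k x)"
    using Suc by (simp add: mult.assoc)
  also have "\<dots> = (\<lambda>x. \<Sum>k\<in>idx_set N. (multinom k * ?b k) * levy_generator \<sigma> b \<nu> (expansion_term F k) x)"
    by (rule levy_generator_sum) (rule smooth_bdd_expansion_term[OF assms])
  also have "\<dots> = (\<lambda>x. \<Sum>k\<in>idx_set (Suc N). multinom k * (?b k * expansion_term F k x))"
    unfolding sum_multinom_Suc
  proof (rule ext, rule sum.cong[OF refl])
    fix x and k :: idx
    obtain k0 k1 k2 k3 k4 where k: "k = (k0, k1, k2, k3, k4)" by (cases k)
    show "multinom k * ?b k * levy_generator \<sigma> b \<nu> (expansion_term F k) x =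
      (case k of (k0, k1, k2, k3, k4) \<Rightarrow> multinom (k0, k1, k2, k3, k4) *
      (?b (Suc k0, k1, k2, k3, k4) * expansion_term F (Suc k0, k1, k2, k3, k4) x
       + ?b (k0, Suc k1, k2, k3, k4) * expansion_term F (k0, Suc k1, k2, k3, k4) x
       + ?b (k0, k1, Suc k2, k3, k4) * expansion_term F (k0, k1, Suc k2, k3, k4) x
       + ?b (k0, k1, k2, Suc k3, k4) * expansion_term F (k0, k1, k2, Suc k3, k4) x
       + ?b (k0, k1, k2, k3, Suc k4) * expansion_term F (k0, k1, k2, k3, Suc k4) x))"
      unfolding k prod.case levy_generator_expansion_term[OF assms]
      by (simp add: algebra_simps del: multinom.simps expansion_term.simps)
  qed
  finally show ?case .
qed

end

section \<open>Convolution powers as integrals over product measures\<close>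

lemma finite_measure_PiM:
  assumes "finite_measure \<mu>" "finite I"
  shows "finite_measure (PiM I (\<lambda>_. \<mu>))"
proof
  interpret finite_measure \<mu> by fact
  interpret product_sigma_finite "\<lambda>_. \<mu>" ..
  show "emeasure (PiM I (\<lambda>_. \<mu>)) (space (PiM I (\<lambda>_. \<mu>))) \<noteq> \<infinity>"
    using assms(2) by (simp add: space_PiM emeasure_PiM power_eq_top_ennreal)
qed

text \<open>Integrating out one coordinate replaces F by \<open>conv \<mu> F\<close>, which is why
  the induction runs over all F.\<close>

lemma (in finite_borel) integral_PiM_sum:
  assumes "finite I" "bdd_borel F"
  shows "(LINT u|PiM I (\<lambda>_. \<mu>). F (x + (\<Sum>i\<in>I. u i))) = (conv \<mu> ^^ card I) F x"
  using assms
proof (induction I arbitrary: F rule: finite_induct)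
  case empty
  interpret product_sigma_finite "\<lambda>_::'a. \<mu>" ..
  show ?case by (simp add: PiM_empty lebesgue_integral_count_space_finite)
next
  case (insert i I)
  interpret product_sigma_finite "\<lambda>_::'a. \<mu>" ..
  interpret P: finite_measure "PiM (insert i I) (\<lambda>_. \<mu>)"
    by (rule finite_measure_PiM) (use insert in \<open>auto intro: finite_measure_axioms\<close>)
  note [measurable] = bdd_borel_measurable[OF insert.prems]
  obtain C where C: "\<And>x. \<bar>F x\<bar> \<le> C" using bdd_borel_bound[OF insert.prems] by metis
  have [measurable]: "(\<lambda>u. \<Sum>j\<in>insert i I. u j) \<in> borel_measurable (PiM (insert i I) (\<lambda>_. \<mu>))"
    by (intro borel_measurable_sum) measurable
  have int: "integrable (PiM (insert i I) (\<lambda>_. \<mu>)) (\<lambda>u. F (x + (\<Sum>j\<in>insert i I. u j)))"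
    by (rule P.integrable_const_bound[of _ C]) (use C in \<open>auto simp del: sum.insert\<close>)
  have sum_upd: "(\<Sum>j\<in>insert i I. (u(i := z)) j) = (\<Sum>j\<in>I. u j) + z" for u :: "'a \<Rightarrow> real" and z
    using insert.hyps by (subst sum.insert) (auto intro!: sum.cong)
  have "(LINT u|PiM (insert i I) (\<lambda>_. \<mu>). F (x + (\<Sum>i\<in>insert i I. u i)))
    = (LINT u|PiM I (\<lambda>_. \<mu>). conv \<mu> F (x + (\<Sum>j\<in>I. u j)))"
    by (subst product_integral_insert[OF insert.hyps int]) (simp only: sum_upd conv_def add.assoc)
  also have "\<dots> = (conv \<mu> ^^ card I) (conv \<mu> F) x"
    by (rule insert.IH) (rule bdd_borel_conv[OF insert.prems])
  finally show ?case using insert.hyps by (simp add: funpow_swap1)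
qed

context truncated_levy
begin

text \<open>The w's and the \<beta>'s live in separate product measures, whereas
  \<open>kappa\<close> couples them in pairs. The induction therefore removes one coordinate of each
  and has to exchange the new w with the old \<beta>'s.\<close>

lemma integral_PiM_small_beta:
  assumes "finite J" "bdd_borel F"
  shows "(LINT w|PiM J (\<lambda>_. small_part c \<nu>). LINT \<beta>|PiM J (\<lambda>_. beta_part). F (x + (\<Sum>j\<in>J. \<beta> j * w j)))
    = (conv kappa ^^ card J) F x"
  using assms
proof (induction J arbitrary: F rule: finite_induct)
  case empty
  interpret w: product_sigma_finite "\<lambda>_::'a. small_part c \<nu>" ..
  interpret b: product_sigma_finite "\<lambda>_::'a. beta_part" ..
  show ?case by (simp add: PiM_empty lebesgue_integral_count_space_finite)
next
  case (insert i I)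
  interpret w: product_sigma_finite "\<lambda>_::'a. small_part c \<nu>" ..
  interpret b: product_sigma_finite "\<lambda>_::'a. beta_part" ..
  interpret W: finite_measure "PiM (insert i I) (\<lambda>_. small_part c \<nu>)"
    by (rule finite_measure_PiM) (use insert in \<open>auto intro: small.finite_measure_axioms\<close>)
  interpret B: finite_measure "PiM (insert i I) (\<lambda>_. beta_part)"
    by (rule finite_measure_PiM) (use insert in \<open>auto intro: beta.finite_measure_axioms\<close>)
  interpret B': finite_measure "PiM I (\<lambda>_. beta_part)"
    by (rule finite_measure_PiM) (use insert in \<open>auto intro: beta.finite_measure_axioms\<close>)
  interpret sB: pair_sigma_finite "small_part c \<nu>" "PiM I (\<lambda>_. beta_part)" ..
  interpret sB': finite_measure "small_part c \<nu> \<Otimes>\<^sub>M PiM I (\<lambda>_. beta_part)"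
    by (rule finite_measure_pair_measure) unfold_locales
  note [measurable] = bdd_borel_measurable[OF insert.prems]
  obtain C where C: "\<And>x. \<bar>F x\<bar> \<le> C" using bdd_borel_bound[OF insert.prems] by metis
  have meas2: "(\<lambda>q. \<Sum>j\<in>A. snd q j * fst q j)
      \<in> borel_measurable (PiM A (\<lambda>_. small_part c \<nu>) \<Otimes>\<^sub>M PiM A (\<lambda>_. beta_part))" for A :: "'a set"
    by (intro borel_measurable_sum) measurable
  have measw: "(\<lambda>\<beta>. \<Sum>j\<in>A. \<beta> j * w j) \<in> borel_measurable (PiM A (\<lambda>_. beta_part))" for A :: "'a set" and w
    by (intro borel_measurable_sum) measurable
  note [measurable] = meas2 measw
  have intb: "integrable (PiM (insert i I) (\<lambda>_. beta_part)) (\<lambda>\<beta>. F (x + (\<Sum>j\<in>insert i I. \<beta> j * w j)))" for w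
    by (rule B.integrable_const_bound[of _ C]) (use C in \<open>auto simp del: sum.insert\<close>)
  have bnd: "\<bar>LINT \<beta>|PiM (insert i I) (\<lambda>_. beta_part). F (x + (\<Sum>j\<in>insert i I. \<beta> j * w j))\<bar>
      \<le> C * measure (PiM (insert i I) (\<lambda>_. beta_part)) (space (PiM (insert i I) (\<lambda>_. beta_part)))" for w
  proof -
    have "\<bar>LINT \<beta>|PiM (insert i I) (\<lambda>_. beta_part). F (x + (\<Sum>j\<in>insert i I. \<beta> j * w j))\<bar>
      \<le> (LINT \<beta>|PiM (insert i I) (\<lambda>_. beta_part). \<bar>F (x + (\<Sum>j\<in>insert i I. \<beta> j * w j))\<bar>)"
      by (rule integral_abs_bound)
    also have "\<dots> \<le> (LINT \<beta>|PiM (insert i I) (\<lambda>_. beta_part). C)"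
      using C by (intro integral_mono integrable_abs intb B.integrable_const) auto
    finally show ?thesis by (simp add: mult.commute)
  qed
  have intw: "integrable (PiM (insert i I) (\<lambda>_. small_part c \<nu>))
      (\<lambda>w. LINT \<beta>|PiM (insert i I) (\<lambda>_. beta_part). F (x + (\<Sum>j\<in>insert i I. \<beta> j * w j)))"
  proof (rule W.integrable_const_bound[OF AE_I2])
    have "(\<lambda>q. F (x + (\<Sum>j\<in>insert i I. snd q j * fst q j)))
      \<in> borel_measurable (PiM (insert i I) (\<lambda>_. small_part c \<nu>) \<Otimes>\<^sub>M PiM (insert i I) (\<lambda>_. beta_part))"
      by measurable
    then show "(\<lambda>w. LINT \<beta>|PiM (insert i I) (\<lambda>_. beta_part). F (x + (\<Sum>j\<in>insert i I. \<beta> j * w j)))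
      \<in> borel_measurable (PiM (insert i I) (\<lambda>_. small_part c \<nu>))"
      by (intro B.borel_measurable_lebesgue_integral) (simp add: case_prod_unfold del: sum.insert)
  qed (simp only: real_norm_def, rule bnd)
  have sum_upd: "(\<Sum>j\<in>insert i I. (\<beta>(i := \<beta>')) j * (w(i := z)) j) = (\<Sum>j\<in>I. \<beta> j * w j) + \<beta>' * z"
    for \<beta> w :: "'a \<Rightarrow> real" and z \<beta>'
    using insert.hyps by (subst sum.insert) (auto intro!: sum.cong)
  \<comment> \<open>Fubini brings z next to its partner \<open>\<beta>'\<close>; integrated together
    they give one convolution with \<open>kappa\<close>.\<close>
  have swap: "(LINT z|small_part c \<nu>. LINT \<beta>|PiM I (\<lambda>_. beta_part). LINT \<beta>'|beta_part. F (x + (\<Sum>j\<in>I. \<beta> j * w j) + \<beta>' * z))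
    = (LINT \<beta>|PiM I (\<lambda>_. beta_part). conv kappa F (x + (\<Sum>j\<in>I. \<beta> j * w j)))" for w
  proof -
    have m3: "(\<lambda>q. F (x + (\<Sum>j\<in>I. snd (fst q) j * w j) + snd q * fst (fst q)))
      \<in> borel_measurable ((small_part c \<nu> \<Otimes>\<^sub>M PiM I (\<lambda>_. beta_part)) \<Otimes>\<^sub>M beta_part)"
      by measurable
    have "integrable (small_part c \<nu> \<Otimes>\<^sub>M PiM I (\<lambda>_. beta_part))
      (\<lambda>(z, \<beta>). LINT \<beta>'|beta_part. F (x + (\<Sum>j\<in>I. \<beta> j * w j) + \<beta>' * z))"
    proof (rule sB'.integrable_const_bound[of _ "C * measure beta_part (space beta_part)"])
      show "(\<lambda>(z, \<beta>). LINT \<beta>'|beta_part. F (x + (\<Sum>j\<in>I. \<beta> j * w j) + \<beta>' * z))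
        \<in> borel_measurable (small_part c \<nu> \<Otimes>\<^sub>M PiM I (\<lambda>_. beta_part))"
        unfolding case_prod_unfold using m3
        by (intro beta.borel_measurable_lebesgue_integral) (simp add: case_prod_unfold)
      have "\<bar>LINT \<beta>'|beta_part. F (v + \<beta>' * z)\<bar> \<le> C * measure beta_part (space beta_part)" for v z
      proof -
        have i: "integrable beta_part (\<lambda>\<beta>'. F (v + \<beta>' * z))"
          by (rule beta.integrable_const_bound[of _ C]) (use C in auto)
        have "\<bar>LINT \<beta>'|beta_part. F (v + \<beta>' * z)\<bar> \<le> (LINT \<beta>'|beta_part. \<bar>F (v + \<beta>' * z)\<bar>)"
          by (rule integral_abs_bound)
        also have "\<dots> \<le> (LINT \<beta>'|beta_part. C)"
          using C i by (intro integral_mono integrable_abs beta.integrable_const) auto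
        finally show ?thesis by (simp add: mult.commute)
      qed
      then show "AE q in small_part c \<nu> \<Otimes>\<^sub>M PiM I (\<lambda>_. beta_part).
        norm (case q of (z, \<beta>) \<Rightarrow> LINT \<beta>'|beta_part. F (x + (\<Sum>j\<in>I. \<beta> j * w j) + \<beta>' * z))
          \<le> C * measure beta_part (space beta_part)"
        by (auto simp: case_prod_unfold)
    qed
    from sB.Fubini_integral[OF this, symmetric] show ?thesis
      by (simp add: conv_kappa[OF insert.prems])
  qed
  have "(LINT w|PiM (insert i I) (\<lambda>_. small_part c \<nu>). LINT \<beta>|PiM (insert i I) (\<lambda>_. beta_part).
      F (x + (\<Sum>j\<in>insert i I. \<beta> j * w j)))
    = (LINT w|PiM I (\<lambda>_. small_part c \<nu>). LINT z|small_part c \<nu>. LINT \<beta>|PiM (insert i I) (\<lambda>_. beta_part).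
      F (x + (\<Sum>j\<in>insert i I. \<beta> j * (w(i := z)) j)))"
    by (rule w.product_integral_insert[OF insert.hyps intw])
  also have "\<dots> = (LINT w|PiM I (\<lambda>_. small_part c \<nu>). LINT z|small_part c \<nu>. LINT \<beta>|PiM I (\<lambda>_. beta_part).
      LINT \<beta>'|beta_part. F (x + (\<Sum>j\<in>I. \<beta> j * w j) + \<beta>' * z))"
    by (subst b.product_integral_insert[OF insert.hyps intb]) (simp only: sum_upd add.assoc)
  also have "\<dots> = (LINT w|PiM I (\<lambda>_. small_part c \<nu>). LINT \<beta>|PiM I (\<lambda>_. beta_part).
      conv kappa F (x + (\<Sum>j\<in>I. \<beta> j * w j)))"
    by (simp only: swap)
  also have "\<dots> = (conv kappa ^^ card I) (conv kappa F) x"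
    by (rule insert.IH) (rule kappa.bdd_borel_conv[OF insert.prems])
  finally show ?case using insert.hyps by (simp add: funpow_swap1)
qed

text \<open>The dictionary between operator powers and the integrals of the statement. Empty index
  sets are allowed, which covers the conventions for integrals over no variables.\<close>

lemma integral_product_eq_conv:
  assumes "finite I" "finite J" "bdd_borel F"
  shows "(LINT (u, w, \<beta>)|(PiM I (\<lambda>_. big_part c \<nu>) \<Otimes>\<^sub>M (PiM J (\<lambda>_. small_part c \<nu>) \<Otimes>\<^sub>M PiM J (\<lambda>_. beta_part))).
      F (x + (\<Sum>i\<in>I. u i) + (\<Sum>j\<in>J. \<beta> j * w j)))
    = (conv (big_part c \<nu>) ^^ card I) ((conv kappa ^^ card J) F) x"
proof -
  interpret W: finite_measure "PiM J (\<lambda>_. small_part c \<nu>)"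
    by (rule finite_measure_PiM) (use assms in \<open>auto intro: small.finite_measure_axioms\<close>)
  interpret B: finite_measure "PiM J (\<lambda>_. beta_part)"
    by (rule finite_measure_PiM) (use assms in \<open>auto intro: beta.finite_measure_axioms\<close>)
  interpret U: finite_measure "PiM I (\<lambda>_. big_part c \<nu>)"
    by (rule finite_measure_PiM) (use assms in \<open>auto intro: big.finite_measure_axioms\<close>)
  interpret WB: pair_sigma_finite "PiM J (\<lambda>_. small_part c \<nu>)" "PiM J (\<lambda>_. beta_part)" ..
  interpret WB': finite_measure "PiM J (\<lambda>_. small_part c \<nu>) \<Otimes>\<^sub>M PiM J (\<lambda>_. beta_part)"
    by (rule finite_measure_pair_measure) unfold_locales
  interpret UWB: pair_sigma_finite "PiM I (\<lambda>_. big_part c \<nu>)" "PiM J (\<lambda>_. small_part c \<nu>) \<Otimes>\<^sub>M PiM J (\<lambda>_. beta_part)" ..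
  interpret UWB': finite_measure "PiM I (\<lambda>_. big_part c \<nu>) \<Otimes>\<^sub>M (PiM J (\<lambda>_. small_part c \<nu>) \<Otimes>\<^sub>M PiM J (\<lambda>_. beta_part))"
    by (rule finite_measure_pair_measure) unfold_locales
  note [measurable] = bdd_borel_measurable[OF assms(3)]
  obtain C where C: "\<And>x. \<bar>F x\<bar> \<le> C" using bdd_borel_bound[OF assms(3)] by metis
  have [measurable]: "(\<lambda>q. \<Sum>j\<in>J. snd q j * fst q j)
      \<in> borel_measurable (PiM J (\<lambda>_. small_part c \<nu>) \<Otimes>\<^sub>M PiM J (\<lambda>_. beta_part))"
    by (intro borel_measurable_sum) measurable
  have [measurable]: "(\<lambda>u. \<Sum>i\<in>I. u i) \<in> borel_measurable (PiM I (\<lambda>_. big_part c \<nu>))"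
    by (intro borel_measurable_sum) measurable
  have "integrable (PiM I (\<lambda>_. big_part c \<nu>) \<Otimes>\<^sub>M (PiM J (\<lambda>_. small_part c \<nu>) \<Otimes>\<^sub>M PiM J (\<lambda>_. beta_part)))
    (\<lambda>q. F (x + (\<Sum>i\<in>I. fst q i) + (\<Sum>j\<in>J. snd (snd q) j * fst (snd q) j)))"
    by (rule UWB'.integrable_const_bound[of _ C]) (use C in \<open>auto\<close>)
  then have 1: "(LINT (u, w, \<beta>)|(PiM I (\<lambda>_. big_part c \<nu>) \<Otimes>\<^sub>M (PiM J (\<lambda>_. small_part c \<nu>) \<Otimes>\<^sub>M PiM J (\<lambda>_. beta_part))).
      F (x + (\<Sum>i\<in>I. u i) + (\<Sum>j\<in>J. \<beta> j * w j)))
    = (LINT u|PiM I (\<lambda>_. big_part c \<nu>). LINT r|(PiM J (\<lambda>_. small_part c \<nu>) \<Otimes>\<^sub>M PiM J (\<lambda>_. beta_part)).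
      F (x + (\<Sum>i\<in>I. u i) + (\<Sum>j\<in>J. snd r j * fst r j)))"
    by (subst UWB.integral_fst'[symmetric]) (auto simp: case_prod_unfold)
  have "integrable (PiM J (\<lambda>_. small_part c \<nu>) \<Otimes>\<^sub>M PiM J (\<lambda>_. beta_part))
    (\<lambda>r. F (v + (\<Sum>j\<in>J. snd r j * fst r j)))" for v
    by (rule WB'.integrable_const_bound[of _ C]) (use C in \<open>auto\<close>)
  from WB.integral_fst'[OF this]
  have 2: "(LINT r|(PiM J (\<lambda>_. small_part c \<nu>) \<Otimes>\<^sub>M PiM J (\<lambda>_. beta_part)). F (v + (\<Sum>j\<in>J. snd r j * fst r j)))
    = (conv kappa ^^ card J) F v" for v
    using integral_PiM_small_beta[OF assms(2,3), of v] by simp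
  show ?thesis
    unfolding 1 2 by (rule big.integral_PiM_sum[OF assms(1)]) (rule kappa.bdd_borel_conv_funpow[OF assms(3)])
qed

end

section \<open>Differentiability with bounds on an open set\<close>

text \<open>Recursion along \<open>deriv\<close> lets sums and products go through by induction on
  the order, with the Leibniz rule as the step; \<open>bdd_diff_iff\<close> recovers the explicit
  form.\<close>

primrec bdd_diff :: "nat \<Rightarrow> real set \<Rightarrow> (real \<Rightarrow> real) \<Rightarrow> bool" where
  "bdd_diff 0 U f \<longleftrightarrow> bounded (f ` U)"
| "bdd_diff (Suc N) U f \<longleftrightarrow> bounded (f ` U) \<and> (\<forall>x\<in>U. f differentiable (at x)) \<and> bdd_diff N U (deriv f)"

lemma bdd_diff_iff:
  "bdd_diff N U f \<longleftrightarrow> (\<forall>j<N. \<forall>x\<in>U. (deriv ^^ j) f differentiable (at x)) \<and>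
     (\<forall>j\<le>N. bounded ((deriv ^^ j) f ` U))"
proof (induction N arbitrary: f)
  case (Suc N)
  show ?case
    unfolding bdd_diff.simps Suc All_less_Suc2 less_Suc_eq_le[symmetric]
    by (auto simp: funpow_Suc_right simp del: funpow.simps(2))
qed simp

lemma bdd_diff_cong:
  assumes "open U" "\<And>x. x \<in> U \<Longrightarrow> f x = g x" "bdd_diff N U f"
  shows "bdd_diff N U g"
  using assms(2,3)
proof (induction N arbitrary: f g)
  case 0
  then show ?case by (auto cong: image_cong)
next
  case (Suc N)
  have ev: "eventually (\<lambda>z. f z = g z) (nhds x)" if "x \<in> U" for x
    using eventually_nhds_in_open[OF assms(1) that] by eventually_elim (rule Suc.prems)
  have "deriv f x = deriv g x" if "x \<in> U" for x
    by (rule deriv_cong_ev[OF ev[OF that] refl])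
  then have "bdd_diff N U (deriv g)"
    using Suc.IH[of "deriv f" "deriv g"] Suc.prems by simp
  moreover have "g differentiable (at x)" if x: "x \<in> U" for x
  proof -
    from Suc.prems x obtain D where "(f has_real_derivative D) (at x)"
      by (auto simp: real_differentiable_def)
    then have "(g has_real_derivative D) (at x)"
      by (rule has_field_derivative_transform_within_open[OF _ assms(1) x]) (rule Suc.prems)
    then show ?thesis by (auto simp: real_differentiable_def)
  qed
  moreover have "f ` U = g ` U" using Suc.prems(1) by (rule image_cong[OF refl])
  ultimately show ?case using Suc.prems by simp
qed

lemma bounded_image_add:
  fixes f g :: "'a \<Rightarrow> real"
  assumes "bounded (f ` U)" "bounded (g ` U)"
  shows "bounded ((\<lambda>x. f x + g x) ` U)"
proof -
  obtain a b where "\<And>x. x \<in> U \<Longrightarrow> \<bar>f x\<bar> \<le> a" "\<And>x. x \<in> U \<Longrightarrow> \<bar>g x\<bar> \<le> b"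
    using assms unfolding bounded_iff by auto
  then have "\<And>x. x \<in> U \<Longrightarrow> \<bar>f x + g x\<bar> \<le> a + b"
    by (meson abs_triangle_ineq add_mono order_trans)
  then show ?thesis unfolding bounded_iff by auto
qed

lemma bounded_image_mult:
  fixes f g :: "'a \<Rightarrow> real"
  assumes "bounded (f ` U)" "bounded (g ` U)"
  shows "bounded ((\<lambda>x. f x * g x) ` U)"
proof -
  obtain a b where "\<And>x. x \<in> U \<Longrightarrow> \<bar>f x\<bar> \<le> a" "\<And>x. x \<in> U \<Longrightarrow> \<bar>g x\<bar> \<le> b"
    using assms unfolding bounded_iff by auto
  then have "\<And>x. x \<in> U \<Longrightarrow> \<bar>f x * g x\<bar> \<le> a * b"
    unfolding abs_mult by (meson abs_ge_zero mult_mono order_trans)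
  then show ?thesis unfolding bounded_iff by auto
qed

lemma bdd_diff_add:
  assumes "open U" "bdd_diff N U f" "bdd_diff N U g"
  shows "bdd_diff N U (\<lambda>x. f x + g x)"
  using assms(2,3)
proof (induction N arbitrary: f g)
  case (Suc N)
  have D: "((\<lambda>x. f x + g x) has_real_derivative deriv f x + deriv g x) (at x)" if "x \<in> U" for x
    using Suc.prems that by (intro DERIV_add) (auto simp: DERIV_deriv_iff_real_differentiable)
  have "bdd_diff N U (\<lambda>x. deriv f x + deriv g x)"
    using Suc by simp
  then have "bdd_diff N U (deriv (\<lambda>x. f x + g x))"
    by (rule bdd_diff_cong[OF assms(1), rotated]) (simp add: DERIV_imp_deriv[OF D])
  with Suc.prems D show ?case
    by (auto intro: bounded_image_add simp: real_differentiable_def)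
qed (auto intro: bounded_image_add)

lemma bdd_diff_Suc_D: "bdd_diff (Suc N) U f \<Longrightarrow> bdd_diff N U f"
  by (auto simp: bdd_diff_iff)

lemma bdd_diff_mult:
  assumes "open U" "bdd_diff N U f" "bdd_diff N U g"
  shows "bdd_diff N U (\<lambda>x. f x * g x)"
  using assms(2,3)
proof (induction N arbitrary: f g)
  case (Suc N)
  have D: "((\<lambda>x. f x * g x) has_real_derivative deriv f x * g x + deriv g x * f x) (at x)" if "x \<in> U" for x
    using Suc.prems that by (intro DERIV_mult) (auto simp: DERIV_deriv_iff_real_differentiable)
  have "bdd_diff N U (\<lambda>x. deriv f x * g x + deriv g x * f x)"
    using Suc.prems bdd_diff_Suc_D[OF Suc.prems(1)] bdd_diff_Suc_D[OF Suc.prems(2)]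
    by (intro bdd_diff_add[OF assms(1)] Suc.IH) auto
  then have "bdd_diff N U (deriv (\<lambda>x. f x * g x))"
    by (rule bdd_diff_cong[OF assms(1), rotated]) (simp add: DERIV_imp_deriv[OF D])
  with Suc.prems D show ?case
    by (auto intro: bounded_image_mult simp: real_differentiable_def)
qed (auto intro: bounded_image_mult)

lemma bdd_diff_const: "bdd_diff N U (\<lambda>_. r)"
proof (induction N arbitrary: r)
  case (Suc N)
  then show ?case by (auto simp: bounded_iff)
qed (auto simp: bounded_iff)

lemma bdd_diff_Un: "bdd_diff N U f \<Longrightarrow> bdd_diff N V f \<Longrightarrow> bdd_diff N (U \<union> V) f"
  by (auto simp: bdd_diff_iff image_Un)

lemma smooth_bdd_imp_bdd_diff: "smooth_bdd f \<Longrightarrow> bdd_diff N U f"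
  by (auto simp: bdd_diff_iff smooth_bdd_def smooth_def intro: bounded_subset)

section \<open>Compactly supported smooth functions and the classes C^N\<close>

lemma funpow_deriv_eq_0:
  fixes f :: "real \<Rightarrow> real"
  assumes "\<And>x. r < \<bar>x\<bar> \<Longrightarrow> f x = 0" "r < \<bar>x\<bar>"
  shows "(deriv ^^ k) f x = 0"
  using assms(2)
proof (induction k arbitrary: x)
  case (Suc k)
  have "open {z :: real. r < \<bar>z\<bar>}" by (intro open_Collect_less continuous_intros)
  then have "eventually (\<lambda>z. z \<in> {z. r < \<bar>z\<bar>}) (nhds x)"
    using Suc.prems by (intro eventually_nhds_in_open) auto
  then have "eventually (\<lambda>z. (deriv ^^ k) f z = 0) (nhds x)"
    by eventually_elim (use Suc.IH in auto)
  then have "deriv ((deriv ^^ k) f) x = deriv (\<lambda>_. 0) x"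
    by (rule deriv_cong_ev) simp
  then show ?case by simp
qed (simp add: assms)

lemma smooth_bdd_compact_support:
  assumes "smooth f" "\<And>x. r < \<bar>x\<bar> \<Longrightarrow> f x = 0"
  shows "smooth_bdd f"
  unfolding smooth_bdd_def
proof (intro conjI allI assms(1))
  fix k
  have "compact ((deriv ^^ k) f ` {-r..r})"
    using continuous_funpow_deriv[OF assms(1)]
    by (intro compact_continuous_image compact_Icc) (rule continuous_on_subset, auto)
  then have "bounded (insert 0 ((deriv ^^ k) f ` {-r..r}))"
    by (simp add: compact_imp_bounded)
  moreover have "range ((deriv ^^ k) f) \<subseteq> insert 0 ((deriv ^^ k) f ` {-r..r})"
  proof clarify
    fix x assume "(deriv ^^ k) f x \<notin> (deriv ^^ k) f ` {-r..r}"
    then have "x \<notin> {-r..r}" by blast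
    then have "r < \<bar>x\<bar>" by auto
    with funpow_deriv_eq_0[of r f] assms(2) show "(deriv ^^ k) f x = 0" by blast
  qed
  ultimately show "bounded (range ((deriv ^^ k) f))" by (rule bounded_subset)
qed

lemma class_C_mono: "class_C N f \<Longrightarrow> j \<le> N \<Longrightarrow> class_C j f"
  unfolding class_C_def
  by (cases "j = N") (auto intro!: continuous_at_imp_continuous_on differentiable_imp_continuous_within)

lemma class_C_continuous: "class_C N f \<Longrightarrow> continuous_on UNIV f"
  using class_C_mono[of N f 0] by (simp add: class_C_def)

lemma class_C_funpow_continuous: "class_C N f \<Longrightarrow> j \<le> N \<Longrightarrow> continuous_on UNIV ((deriv ^^ j) f)"
  using class_C_mono[of N f j] by (simp add: class_C_def)

lemma class_C_Suc_iff:
  "class_C (Suc N) f \<longleftrightarrow> (\<forall>x. f differentiable (at x)) \<and> class_C N (deriv f)"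
  unfolding class_C_def All_less_Suc2
  by (auto simp: funpow_Suc_right simp del: funpow.simps(2))

section \<open>Mollification\<close>

text \<open>Smoothing by the rescaled bump, after substituting v = m u: the weight no longer depends
  on m, so a multiple of \<phi> dominates the integrands for all m.\<close>

definition mollify :: "(real \<Rightarrow> real) \<Rightarrow> nat \<Rightarrow> (real \<Rightarrow> real) \<Rightarrow> real \<Rightarrow> real" where
  "mollify \<phi> m g x = (LBINT v. \<phi> v * g (x + v / real m))"

locale bump_function =
  fixes \<phi> :: "real \<Rightarrow> real"
  assumes bump: "bump \<phi>"
begin

lemma smooth_phi: "smooth \<phi>" and phi_nonneg: "0 \<le> \<phi> x" and phi_eq_0: "1 < \<bar>x\<bar> \<Longrightarrow> \<phi> x = 0"
  and integral_phi: "(LBINT x. \<phi> x) = 1"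
  using bump by (auto simp: bump_def)

text \<open>A non-integrable function has Bochner integral 0 by convention, so the value 1 forces
  integrability.\<close>

lemma integrable_phi: "integrable lborel \<phi>"
  using not_integrable_integral_eq[of lborel \<phi>] integral_phi by auto

lemma smooth_bdd_phi: "smooth_bdd \<phi>"
  by (rule smooth_bdd_compact_support[OF smooth_phi phi_eq_0])

lemma phi_measurable [measurable]: "\<phi> \<in> borel_measurable borel"
  by (rule bdd_borel_measurable[OF smooth_bdd_imp_bdd_borel[OF smooth_bdd_phi]])

lemma abs_mollify_le:
  assumes "\<And>v. \<bar>v\<bar> \<le> 1 \<Longrightarrow> \<bar>g (x + v / real m)\<bar> \<le> C"
  shows "\<bar>mollify \<phi> m g x\<bar> \<le> C"
proof -
  have C: "0 \<le> C" using assms[of 0] by simp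
  have "\<bar>mollify \<phi> m g x\<bar> \<le> (LBINT v. \<bar>\<phi> v * g (x + v / real m)\<bar>)"
    unfolding mollify_def by (rule integral_abs_bound)
  also have "\<dots> \<le> (LBINT v. C * \<phi> v)"
  proof (rule integral_mono')
    show "\<bar>\<phi> v * g (x + v / real m)\<bar> \<le> C * \<phi> v" for v
      using mult_left_mono[OF assms[of v] phi_nonneg[of v]] phi_nonneg[of v] phi_eq_0[of v]
      by (cases "\<bar>v\<bar> \<le> 1") (auto simp: abs_mult mult.commute)
  qed (use integrable_phi C phi_nonneg in auto)
  finally show ?thesis by (simp add: integral_phi)
qed

lemma mollify_tendsto:
  assumes "continuous_on UNIV g" "\<And>x. \<bar>g x\<bar> \<le> C"
  shows "(\<lambda>m. mollify \<phi> m g x) \<longlonglongrightarrow> g x"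
proof -
  have [measurable]: "g \<in> borel_measurable borel"
    by (rule borel_measurable_continuous_onI[OF assms(1)])
  have "(\<lambda>m. LBINT v. \<phi> v * g (x + v / real m)) \<longlonglongrightarrow> (LBINT v. \<phi> v * g x)"
  proof (rule integral_dominated_convergence[where w="\<lambda>v. C * \<phi> v"])
    show "AE v in lborel. (\<lambda>m. \<phi> v * g (x + v / real m)) \<longlonglongrightarrow> \<phi> v * g x"
    proof (intro AE_I2 tendsto_mult tendsto_const)
      fix v :: real
      have "(\<lambda>m. x + v / real m) \<longlonglongrightarrow> x + 0"
        by (intro tendsto_add tendsto_const lim_const_over_n)
      then show "(\<lambda>m. g (x + v / real m)) \<longlonglongrightarrow> g x"
        using assms(1) by (intro isCont_tendsto_compose[of x g]) (auto simp: continuous_on_eq_continuous_at)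
    qed
    show "AE v in lborel. norm (\<phi> v * g (x + v / real m)) \<le> C * \<phi> v" for m
    proof (intro AE_I2)
      fix v
      show "norm (\<phi> v * g (x + v / real m)) \<le> C * \<phi> v"
        using mult_left_mono[OF assms(2)[of "x + v / real m"] phi_nonneg[of v]] phi_nonneg[of v]
        by (simp add: abs_mult mult.commute)
    qed
  qed (use integrable_phi in auto)
  then show ?thesis by (simp add: mollify_def integral_phi)
qed

text \<open>Each integration by parts costs a sign and, from the inner derivative, a factor 1/m; the
  boundary terms vanish with the bump.\<close>

lemma integral_by_parts_phi:
  assumes "class_C j g" "0 < m"
  shows "(LBINT v. (deriv ^^ j) \<phi> v * g (a + v / real m))
    = (- 1 / real m) ^ j * mollify \<phi> m ((deriv ^^ j) g) a"
  using assms(1)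
proof (induction j arbitrary: g)
  case 0
  then show ?case by (simp add: mollify_def)
next
  case (Suc j)
  let ?G = "(deriv ^^ j) \<phi>" and ?g = "(deriv ^^ Suc j) \<phi>"
  let ?F = "\<lambda>v. g (a + v / real m)" and ?f = "\<lambda>v. deriv g (a + v / real m) / real m"
  have g: "g differentiable (at x)" for x
    using Suc.prems by (auto simp: class_C_Suc_iff)
  have g': "class_C j (deriv g)"
    using Suc.prems by (auto simp: class_C_Suc_iff)
  have F: "(?F has_real_derivative ?f v) (at v)" for v
  proof -
    have "(?F has_real_derivative deriv g (a + v / real m) * (1 / real m)) (at v)"
    proof -
      have "(g has_real_derivative deriv g (a + v / real m)) (at (a + v / real m))"
        using g by (simp add: DERIV_deriv_iff_real_differentiable)
      moreover have "((\<lambda>v. a + v / real m) has_real_derivative 1 / real m) (at v)"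
        using DERIV_add[OF DERIV_const DERIV_cdivide[OF DERIV_ident]] by simp
      ultimately show ?thesis by (rule DERIV_chain2)
    qed
    then show ?thesis by simp
  qed
  have "isCont (deriv g) x" for x
    using class_C_continuous[OF g'] by (simp add: continuous_on_eq_continuous_at)
  then have f: "isCont ?f v" for v
    using assms(2) by (intro continuous_intros isCont_o2[of _ "\<lambda>v. a + v / real m" "deriv g"]) auto
  have zero: "(deriv ^^ k) \<phi> v = 0" if "1 < \<bar>v\<bar>" for k v
    using funpow_deriv_eq_0[of 1 \<phi>] phi_eq_0 that by blast
  \<comment> \<open>An interval strictly larger than [-1, 1] is used because vanishing is known only
    for |v| > 1; this disposes of the boundary terms at once.\<close>
  have ind: "(deriv ^^ k) \<phi> v * indicator {-2..2} v = (deriv ^^ k) \<phi> v" for k v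
    using zero[of v k] by (cases "1 < \<bar>v\<bar>") (auto simp: indicator_def abs_le_iff not_less)
  have "(LBINT v. (?F v * ?g v) * indicator {-2..2} v)
    = ?F 2 * ?G 2 - ?F (-2) * ?G (-2) - (LBINT v. (?f v * ?G v) * indicator {-2..2} v)"
    using continuous_funpow_deriv[OF smooth_phi, of "Suc j"] f F has_real_derivative_funpow_deriv[OF smooth_phi]
    by (intro integral_by_parts) (auto simp: continuous_on_eq_continuous_at)
  then have "(LBINT v. ?g v * ?F v) = - (LBINT v. ?G v * ?f v)"
    unfolding mult.assoc ind by (simp add: zero mult.commute)
  also have "\<dots> = (- 1 / real m) * (LBINT v. ?G v * deriv g (a + v / real m))"
    by simp
  also have "\<dots> = (- 1 / real m) ^ Suc j * mollify \<phi> m ((deriv ^^ Suc j) g) a"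
    unfolding Suc.IH[OF g'] by (simp add: funpow_swap1)
  finally show ?case .
qed

text \<open>The distribution function of the bump. Every mollified indicator with m > 0 is a
  rescaled copy of it, so bounds and derivative are found once.\<close>

definition phi_int :: "real \<Rightarrow> real" where
  "phi_int z = (LBINT u. indicator {..z} u * \<phi> u)"

lemma integrable_phi_indicator: "integrable lborel (\<lambda>u. indicator {..z} u * \<phi> u)"
  by (rule Bochner_Integration.integrable_bound[OF integrable_phi]) (auto simp: indicator_def)

lemma phi_int_bounds: "0 \<le> phi_int z" "phi_int z \<le> 1"
proof -
  show "0 \<le> phi_int z" unfolding phi_int_def
    using phi_nonneg by (intro Bochner_Integration.integral_nonneg) auto
  show "phi_int z \<le> 1" unfolding phi_int_def integral_phi[symmetric]
    using phi_nonneg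
    by (intro integral_mono integrable_phi_indicator integrable_phi) (auto simp: indicator_def)
qed

lemma phi_int_eq_0: "z < - 1 \<Longrightarrow> phi_int z = 0"
  unfolding phi_int_def
  by (rule integral_eq_zero_AE) (auto simp: indicator_def intro!: phi_eq_0)

lemma phi_int_eq_1: "1 < z \<Longrightarrow> phi_int z = 1"
proof -
  assume "1 < z"
  then have "phi_int z = (LBINT x. \<phi> x)"
    unfolding phi_int_def
    by (intro Bochner_Integration.integral_cong) (auto simp: indicator_def phi_eq_0)
  then show ?thesis by (simp add: integral_phi)
qed

lemma phi_int_has_derivative: "(phi_int has_real_derivative \<phi> z) (at z)"
proof -
  have cont: "isCont \<phi> x" for x by (rule smooth_bdd_isCont[OF smooth_bdd_phi])
  obtain \<Psi> where \<Psi>: "\<And>x. (\<Psi> has_vector_derivative \<phi> x) (at x)"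
    using einterval_antiderivative[of "-\<infinity>" \<infinity> \<phi>] cont by auto
  have FTC: "(LBINT u. indicator {a..z} u * \<phi> u) = \<Psi> z - \<Psi> a" if "a \<le> z" for a z
  proof -
    have "has_bochner_integral lborel (\<lambda>u. indicator {a..z} u *\<^sub>R \<phi> u) (\<Psi> z - \<Psi> a)"
      using that \<Psi> cont
      by (intro has_bochner_integral_FTC_Icc)
        (auto simp: has_vector_derivative_at_within intro!: continuous_at_imp_continuous_on)
    then show ?thesis by (simp add: has_bochner_integral_integral_eq)
  qed
  have "phi_int z = \<Psi> z - \<Psi> (- 2)" for z
  proof -
    \<comment> \<open>The fundamental theorem is at hand on compact intervals, so the lower limit is
      replaced by a point left of the support; the minimum covers z < -2 as well.\<close>
    let ?a = "min z (- 2)"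
    have "phi_int z = (LBINT u. indicator {?a..z} u * \<phi> u)"
      unfolding phi_int_def
      by (intro Bochner_Integration.integral_cong) (auto simp: indicator_def intro!: phi_eq_0)
    also have "\<dots> = \<Psi> z - \<Psi> ?a" by (rule FTC) simp
    also have "\<Psi> ?a = \<Psi> (- 2)"
    proof -
      have "\<Psi> (- 2) - \<Psi> ?a = (LBINT u. indicator {?a..- 2} u * \<phi> u)" by (rule FTC[symmetric]) simp
      also have "\<dots> = 0"
        by (rule integral_eq_zero_AE) (auto simp: indicator_def intro!: phi_eq_0)
      finally show ?thesis by simp
    qed
    finally show ?thesis .
  qed
  then have "phi_int = (\<lambda>z. \<Psi> z - \<Psi> (- 2))" by auto
  moreover have "((\<lambda>z. \<Psi> z - \<Psi> (- 2)) has_real_derivative \<phi> z - 0) (at z)"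
    using \<Psi> by (intro DERIV_diff DERIV_const) (simp add: has_real_derivative_iff_has_vector_derivative)
  ultimately show ?thesis by simp
qed

lemma mollified_indicator_eq:
  assumes "0 < m"
  shows "mollified_indicator \<phi> y m x = phi_int (real m * (x - y))"
proof -
  have "phi_int (real m * (x - y)) = real m * (LBINT u. indicator {..real m * (x - y)} (real m * u) * \<phi> (real m * u))"
    unfolding phi_int_def using assms by (subst lborel_integral_real_affine[where c="real m" and t=0]) auto
  also have "\<dots> = (LBINT u. real m * (indicator {..real m * (x - y)} (real m * u) * \<phi> (real m * u)))"
    by simp
  also have "\<dots> = (LBINT u. indicator {..x - y} u * (real m * \<phi> (real m * u)))"
    using assms by (intro Bochner_Integration.integral_cong) (auto simp: indicator_def)
  finally show ?thesis
    unfolding mollified_indicator_def set_lebesgue_integral_def real_scaleR_def by (rule sym)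
qed

lemma
  assumes "0 < m"
  shows smooth_bdd_mollified_indicator: "smooth_bdd (mollified_indicator \<phi> y m)"
    and deriv_mollified_indicator: "(deriv ^^ Suc j) (mollified_indicator \<phi> y m) =
      (\<lambda>x. real m ^ Suc j * (deriv ^^ j) \<phi> (real m * (x - y)))"
proof -
  define F where "F j = (case j of 0 \<Rightarrow> mollified_indicator \<phi> y m
    | Suc j \<Rightarrow> (\<lambda>x. real m ^ Suc j * (deriv ^^ j) \<phi> (real m * (x - y))))" for j
  have inner: "((\<lambda>x. real m * (x - y)) has_real_derivative real m) (at x)" for x
    by (auto intro!: derivative_eq_intros)
  have D: "(F j has_real_derivative F (Suc j) x) (at x)" for j x
  proof (cases j)
    case 0
    have "((\<lambda>x. phi_int (real m * (x - y))) has_real_derivative \<phi> (real m * (x - y)) * real m) (at x)"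
      by (rule DERIV_chain2[OF phi_int_has_derivative inner])
    moreover have "F 0 = (\<lambda>x. phi_int (real m * (x - y)))"
      by (simp add: F_def mollified_indicator_eq[OF assms] fun_eq_iff)
    ultimately show ?thesis unfolding 0 by (simp add: F_def mult.commute)
  next
    case (Suc i)
    have "((\<lambda>x. real m ^ Suc i * (deriv ^^ i) \<phi> (real m * (x - y))) has_real_derivative
      real m ^ Suc i * ((deriv ^^ Suc i) \<phi> (real m * (x - y)) * real m)) (at x)"
      by (intro DERIV_cmult DERIV_chain2[OF has_real_derivative_funpow_deriv[OF smooth_phi] inner])
    then show ?thesis unfolding Suc by (simp add: F_def mult_ac)
  qed
  have F0: "F 0 = mollified_indicator \<phi> y m" by (simp add: F_def)
  have eq: "(deriv ^^ j) (mollified_indicator \<phi> y m) = F j" for j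
    using funpow_deriv_eqI[of F, OF D] by (simp add: F0)
  then show "(deriv ^^ Suc j) (mollified_indicator \<phi> y m) =
      (\<lambda>x. real m ^ Suc j * (deriv ^^ j) \<phi> (real m * (x - y)))"
    by (simp only: F_def nat.case)
  have "bounded (range (F j))" for j
  proof (cases j)
    case 0
    then show ?thesis
      using phi_int_bounds unfolding bounded_iff
      by (auto simp: F_def mollified_indicator_eq[OF assms] intro!: exI[of _ 1])
  next
    case (Suc i)
    obtain C where "\<And>x. \<bar>(deriv ^^ i) \<phi> x\<bar> \<le> C"
      using bdd_borel_bound[OF smooth_bdd_imp_bdd_borel[OF smooth_bdd_funpow_deriv[OF smooth_bdd_phi]]] by metis
    then have "\<bar>F j x\<bar> \<le> real m ^ Suc i * C" for x
      unfolding Suc by (auto simp: F_def abs_mult intro!: mult_left_mono)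
    then show ?thesis unfolding bounded_iff by auto
  qed
  then show "smooth_bdd (mollified_indicator \<phi> y m)"
    using smoothI[of F, OF D] eq by (simp add: smooth_bdd_def F0)
qed

lemma mollified_indicator_tendsto:
  "(\<lambda>m. mollified_indicator \<phi> y m x) \<longlonglongrightarrow> (if x < y then 0 else if x = y then phi_int 0 else 1)"
proof -
  \<comment> \<open>The sequence is eventually constant: for x \<noteq> y as soon as m |x - y| > 1,
    and at x = y from m = 1 on.\<close>
  have "eventually (\<lambda>m. mollified_indicator \<phi> y m x = (if x < y then 0 else if x = y then phi_int 0 else 1)) sequentially"
  proof (cases "x = y")
    case True
    show ?thesis
      using eventually_gt_at_top[of "0 :: nat"]
      by eventually_elim (simp add: True mollified_indicator_eq)
  next
    case False
    obtain N :: nat where N: "1 / \<bar>x - y\<bar> < real N" using reals_Archimedean2 by blast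
    show ?thesis
      using eventually_gt_at_top[of N]
    proof eventually_elim
      case (elim m)
      then have m: "0 < m" "1 / \<bar>x - y\<bar> < real m" using N by auto
      then have *: "1 < real m * \<bar>x - y\<bar>" using False by (simp add: divide_less_eq)
      show ?case
      proof (cases "x < y")
        case True
        with * have "real m * (x - y) < - 1" by (simp add: algebra_simps)
        with True m show ?thesis by (simp add: mollified_indicator_eq phi_int_eq_0)
      next
        case f: False
        with * \<open>x \<noteq> y\<close> have "1 < real m * (x - y)" by (simp add: algebra_simps)
        with f \<open>x \<noteq> y\<close> m show ?thesis by (simp add: mollified_indicator_eq phi_int_eq_1)
      qed
    qed
  qed
  then show ?thesis by (rule tendsto_eventually)
qed

text \<open>Integration by parts moves all but one of the derivatives onto the density.\<close>

lemma conv_density_mollified_indicator: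
  assumes "class_C j g" "\<And>x. 0 \<le> g x" "0 < m"
  shows "conv (density lborel (\<lambda>x. ennreal (g x))) ((deriv ^^ Suc j) (mollified_indicator \<phi> y m)) x
    = (- 1) ^ j * mollify \<phi> m ((deriv ^^ j) g) (y - x)"
proof -
  have [measurable]: "g \<in> borel_measurable borel"
    by (rule borel_measurable_continuous_onI[OF class_C_continuous[OF assms(1)]])
  have [measurable]: "(deriv ^^ j) \<phi> \<in> borel_measurable borel"
    by (rule borel_measurable_continuous_onI[OF continuous_funpow_deriv[OF smooth_phi]])
  have "conv (density lborel (\<lambda>x. ennreal (g x))) ((deriv ^^ Suc j) (mollified_indicator \<phi> y m)) x
    = (LBINT z. g z * (real m ^ Suc j * (deriv ^^ j) \<phi> (real m * (x + z - y))))"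
    unfolding conv_def deriv_mollified_indicator[OF assms(3)]
    using assms(2) by (subst integral_density) auto
  \<comment> \<open>The substitution z = y - x + v/m turns the argument of the bump into v. Its
    factor 1/m leaves m^j, which the integrations by parts then cancel up to sign.\<close>
  also have "\<dots> = \<bar>1 / real m\<bar> * (LBINT v. g (y - x + 1 / real m * v) *
      (real m ^ Suc j * (deriv ^^ j) \<phi> (real m * (x + (y - x + 1 / real m * v) - y))))"
    using assms(3) by (subst lborel_integral_real_affine[where c="1 / real m" and t="y - x"]) auto
  also have "\<dots> = \<bar>1 / real m\<bar> * (LBINT v. real m ^ Suc j * ((deriv ^^ j) \<phi> v * g (y - x + v / real m)))"
  proof -
    have "real m * (x + (y - x + 1 / real m * v) - y) = v" "1 / real m * v = v / real m" for v
      using assms(3) by (simp_all add: field_simps)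
    then show ?thesis by (simp only: mult_ac)
  qed
  also have "\<dots> = real m ^ j * (LBINT v. (deriv ^^ j) \<phi> v * g (y - x + v / real m))"
    using assms(3) by simp
  also have "\<dots> = real m ^ j * ((- 1 / real m) ^ j * mollify \<phi> m ((deriv ^^ j) g) (y - x))"
    by (subst integral_by_parts_phi[OF assms(1,3)]) simp
  also have "\<dots> = (real m * (- 1 / real m)) ^ j * mollify \<phi> m ((deriv ^^ j) g) (y - x)"
    by (simp only: power_mult_distrib mult.assoc)
  finally show ?thesis using assms(3) by simp
qed

end

section \<open>The density of the large jumps\<close>

context truncated_levy
begin

lemma
  assumes "\<And>k x. k < N \<Longrightarrow> x \<noteq> 0 \<Longrightarrow> (deriv ^^ k) s differentiable (at x)"
    and "\<And>k \<delta>. k \<le> N \<Longrightarrow> 0 < \<delta> \<Longrightarrow> bdd_above ((\<lambda>x. \<bar>(deriv ^^ k) s x\<bar>) ` {x. \<delta> < \<bar>x\<bar>})"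
    and "j < N"
  shows class_C_large_density: "class_C j (\<lambda>x. (1 - c x) * s x)"
    and bdd_borel_large_density: "bdd_borel ((deriv ^^ j) (\<lambda>x. (1 - c x) * s x))"
proof -
  let ?h = "\<lambda>x. (1 - c x) * s x"
  \<comment> \<open>Two overlapping open sets covering the line: on \<open>?U\<close> the bounds for
    s away from 0 apply, on \<open>?V\<close> the factor 1 - c is identically 0.\<close>
  let ?U = "{x :: real. \<epsilon> / 4 < \<bar>x\<bar>}" and ?V = "{x :: real. \<bar>x\<bar> < \<epsilon> / 2}"
  have oU: "open ?U" and oV: "open ?V"
    by (intro open_Collect_less continuous_intros)+
  have "bdd_diff N ?U s"
    unfolding bdd_diff_iff
  proof (intro conjI allI impI ballI)
    show "(deriv ^^ k) s differentiable at x" if "k < N" "x \<in> ?U" for k x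
      using that eps by (intro assms(1)) auto
    show "bounded ((deriv ^^ k) s ` ?U)" if "k \<le> N" for k
      using assms(2)[OF that, of "\<epsilon> / 4"] eps unfolding bdd_above_def bounded_iff by auto
  qed
  moreover have "smooth_bdd c"
    by (rule smooth_bdd_compact_support[OF smooth_c c_eq_0])
  ultimately have "bdd_diff N ?U (\<lambda>x. s x + (- 1) * (c x * s x))"
    using smooth_bdd_imp_bdd_diff by (intro bdd_diff_add bdd_diff_mult oU bdd_diff_const)
  then have U: "bdd_diff N ?U ?h"
    by (rule bdd_diff_cong[OF oU, rotated]) (simp add: algebra_simps)
  have V: "bdd_diff N ?V ?h"
    by (rule bdd_diff_cong[OF oV, of "\<lambda>_. 0"]) (use c_eq_1 bdd_diff_const in auto)
  have "?U \<union> ?V = UNIV" using eps by auto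
  with bdd_diff_Un[OF U V] have "bdd_diff N UNIV ?h" by simp
  then have diff: "\<And>k x. k < N \<Longrightarrow> (deriv ^^ k) ?h differentiable (at x)"
    and bdd: "bounded (range ((deriv ^^ j) ?h))"
    using assms(3) by (auto simp: bdd_diff_iff)
  have cont: "continuous_on UNIV ((deriv ^^ j) ?h)"
    using diff[OF assms(3)]
    by (intro continuous_at_imp_continuous_on ballI differentiable_imp_continuous_within)
  show "class_C j ?h"
    using diff assms(3) cont by (auto simp: class_C_def)
  show "bdd_borel ((deriv ^^ j) ?h)"
    using bdd borel_measurable_continuous_onI[OF cont] by (simp add: bdd_borel_def)
qed

lemma big_part_eq_density:
  assumes "\<nu> = density lborel (\<lambda>x. ennreal (s x))"
    and "\<And>x. x \<noteq> 0 \<Longrightarrow> 0 \<le> s x" and "\<And>x. x \<noteq> 0 \<Longrightarrow> s differentiable (at x)"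
  shows "big_part c \<nu> = density lborel (\<lambda>x. ennreal ((1 - c x) * s x))"
proof -
  \<comment> \<open>Borel measurability of s, needed to multiply densities: s is continuous off 0,
    and its value at 0 is patched in separately.\<close>
  have "continuous_on (- {0}) s"
    using assms(3) by (intro continuous_at_imp_continuous_on ballI differentiable_imp_continuous_within) auto
  then have "(\<lambda>x. indicator (- {0}) x *\<^sub>R s x) \<in> borel_measurable borel"
    by (intro borel_measurable_continuous_on_indicator) auto
  then have "(\<lambda>x. indicator (- {0}) x *\<^sub>R s x + indicator {0} x * s 0) \<in> borel_measurable borel"
    by measurable
  also have "(\<lambda>x. indicator (- {0}) x *\<^sub>R s x + indicator {0} x * s 0) = s"
    by (auto simp: indicator_def)
  finally have [measurable]: "s \<in> borel_measurable borel" .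
  have "big_part c \<nu> = density lborel (\<lambda>x. ennreal (s x) * ennreal (1 - c x))"
    unfolding big_part_def assms(1) by (rule density_density_eq) auto
  also have "(\<lambda>x. ennreal (s x) * ennreal (1 - c x)) = (\<lambda>x. ennreal ((1 - c x) * s x))"
    using c_bounds by (intro ext) (simp add: mult.commute ennreal_mult'')
  finally show ?thesis .
qed

end

section \<open>Measurability in time\<close>

text \<open>The process is measurable at each fixed time only, so measurability in \<alpha> has to
  come from the paths: right-continuity exhibits the expectation as a limit of step
  functions.\<close>

lemma measurable_expectation_levy_process:
  fixes g :: "real \<Rightarrow> real"
  assumes X: "levy_process M X" and g: "continuous_on UNIV g" "\<And>x. \<bar>g x\<bar> \<le> C" and t: "0 < t"
  shows "(\<lambda>\<alpha>. indicator {0..} \<alpha> * (LINT \<omega>|M. g (X (\<alpha> * t) \<omega>))) \<in> borel_measurable borel"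
proof -
  interpret prob_space M using X by (simp add: levy_process_def)
  have X_meas: "X u \<in> borel_measurable M" if "0 \<le> u" for u
    using X that by (simp add: levy_process_def)
  have g_meas [measurable]: "g \<in> borel_measurable borel"
    by (rule borel_measurable_continuous_onI[OF g(1)])
  \<comment> \<open>The next point of the grid of mesh 1/(k + 1) strictly to the right of \<alpha>;
    floor plus one rather than ceiling, because \<open>at_right\<close> excludes the point
    itself.\<close>
  define a where "a k \<alpha> = (real_of_int \<lfloor>real (Suc k) * \<alpha>\<rfloor> + 1) / real (Suc k)" for k \<alpha>
  have a: "\<alpha> < a k \<alpha>" "a k \<alpha> \<le> \<alpha> + 1 / real (Suc k)" for k \<alpha>
  proof -
    have "real (Suc k) * \<alpha> < real_of_int \<lfloor>real (Suc k) * \<alpha>\<rfloor> + 1"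
      "real_of_int \<lfloor>real (Suc k) * \<alpha>\<rfloor> \<le> real (Suc k) * \<alpha>" by linarith+
    then show "\<alpha> < a k \<alpha>" "a k \<alpha> \<le> \<alpha> + 1 / real (Suc k)"
      unfolding a_def by (simp_all add: field_simps del: of_nat_Suc)
  qed
  let ?e = "\<lambda>k \<alpha>. indicator {0..} \<alpha> * (LINT \<omega>|M. g (X (a k \<alpha> * t) \<omega>))"
  show ?thesis
  proof (rule borel_measurable_LIMSEQ_real[where u="?e"])
    show "?e k \<in> borel_measurable borel" for k
    proof -
      \<comment> \<open>Only the integer part enters, and any function on a discrete space is
        measurable, whatever its values at negative times.\<close>
      have "(\<lambda>\<alpha>. (\<lambda>i. LINT \<omega>|M. g (X ((real_of_int i + 1) / real (Suc k) * t) \<omega>)) \<lfloor>real (Suc k) * \<alpha>\<rfloor>)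
        \<in> borel_measurable borel"
        by (rule measurable_compose[where N="count_space UNIV"]) measurable
      then show ?thesis unfolding a_def by measurable
    qed
    show "(\<lambda>k. ?e k \<alpha>) \<longlonglongrightarrow> indicator {0..} \<alpha> * (LINT \<omega>|M. g (X (\<alpha> * t) \<omega>))" for \<alpha>
    proof (cases "0 \<le> \<alpha>")
      case True
      have lim_a: "(\<lambda>k. a k \<alpha>) \<longlonglongrightarrow> \<alpha>"
      proof (rule tendsto_sandwich[where f="\<lambda>_. \<alpha>" and h="\<lambda>k. \<alpha> + 1 / real (Suc k)"])
        show "(\<lambda>k. \<alpha> + 1 / real (Suc k)) \<longlonglongrightarrow> \<alpha>"
          using tendsto_add[OF tendsto_const LIMSEQ_inverse_real_of_nat, of \<alpha>]
          by (simp add: inverse_eq_divide)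
      qed (use a in \<open>auto intro!: always_eventually less_imp_le\<close>)
      have lim_at: "filterlim (\<lambda>k. a k \<alpha> * t) (at_right (\<alpha> * t)) sequentially"
        unfolding filterlim_at
      proof
        show "\<forall>\<^sub>F k in sequentially. a k \<alpha> * t \<in> {\<alpha> * t<..} \<and> a k \<alpha> * t \<noteq> \<alpha> * t"
          using a(1) t by (intro always_eventually) (auto simp: less_imp_neq[symmetric])
        show "((\<lambda>k. a k \<alpha> * t) \<longlongrightarrow> \<alpha> * t) sequentially"
          by (intro tendsto_intros lim_a)
      qed
      have "(\<lambda>k. LINT \<omega>|M. g (X (a k \<alpha> * t) \<omega>)) \<longlonglongrightarrow> (LINT \<omega>|M. g (X (\<alpha> * t) \<omega>))"
      proof (rule integral_dominated_convergence[where w="\<lambda>_. C"])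
        show "(\<lambda>\<omega>. g (X (\<alpha> * t) \<omega>)) \<in> borel_measurable M"
          using X_meas[of "\<alpha> * t"] True t by (intro measurable_compose[OF _ g_meas]) auto
        show "(\<lambda>\<omega>. g (X (a k \<alpha> * t) \<omega>)) \<in> borel_measurable M" for k
          using X_meas[of "a k \<alpha> * t"] True t a(1)[of \<alpha> k] by (intro measurable_compose[OF _ g_meas]) auto
        have "AE \<omega> in M. cadlag (\<lambda>t. X t \<omega>)" using X by (simp add: levy_process_def)
        then show "AE \<omega> in M. (\<lambda>k. g (X (a k \<alpha> * t) \<omega>)) \<longlonglongrightarrow> g (X (\<alpha> * t) \<omega>)"
        proof eventually_elim
          case (elim \<omega>)
          have "continuous (at_right (\<alpha> * t)) (\<lambda>t. X t \<omega>)"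
            using elim True t by (simp add: cadlag_def)
          then have "((\<lambda>t. X t \<omega>) \<longlongrightarrow> X (\<alpha> * t) \<omega>) (at_right (\<alpha> * t))"
            by (simp add: continuous_within)
          from filterlim_compose[OF this lim_at]
          show ?case
            using g(1) by (intro isCont_tendsto_compose[of _ g]) (auto simp: continuous_on_eq_continuous_at)
        qed
      qed (use g(2) in auto)
      then show ?thesis by (intro tendsto_intros)
    qed simp
  qed
qed


section \<open>The limit of a single term\<close>

text \<open>The sign from j = l - 1 integrations by parts depends only on the parity of
  \<open>k1\<close>. For k1 = 0 the exponent is -1 and j is odd.\<close>

lemma neg_one_powi_ell:
  assumes "k1 + 2 * k2 + 2 * k4 = Suc j"
  shows "(- 1 :: real) powi (int k1 - 1) = (- 1) ^ j"
proof (cases k1)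
  case 0
  then have "even (Suc j)" using assms by (metis add_0 dvd_triv_left even_add)
  then show ?thesis using 0 by (simp add: power_int_minus)
next
  case (Suc i)
  then have "j = i + 2 * (k2 + k4)" using assms by simp
  then show ?thesis using Suc by (simp add: power_add power_int_of_nat)
qed

text \<open>The inequality for \<delta> and N is a budget: starting at y, up to n + 1 displacements
  by \<epsilon> and one mollification window of width 1/N still leave the argument further than
  \<delta> from the origin.\<close>

locale remainder_terms = truncated_levy \<epsilon> c \<nu> + bump_function \<phi> + prob_space M
  for \<epsilon> c \<nu> \<phi> and M :: "'a measure" +
  fixes X :: "real \<Rightarrow> 'a \<Rightarrow> real" and s :: "real \<Rightarrow> real" and p :: "real \<Rightarrow> real \<Rightarrow> real"
    and t0 y \<delta> :: real and n N :: nat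
  assumes X_measurable: "\<And>u. 0 \<le> u \<Longrightarrow> X u \<in> borel_measurable M"
    and nu_density: "\<nu> = density lborel (\<lambda>x. ennreal (s x))"
    and s_nonneg: "\<And>x. x \<noteq> 0 \<Longrightarrow> 0 \<le> s x"
    and s_diff: "\<And>k x. k < 2 * n + 1 \<Longrightarrow> x \<noteq> 0 \<Longrightarrow> (deriv ^^ k) s differentiable (at x)"
    and s_bdd: "\<And>k \<delta>. k \<le> 2 * n + 1 \<Longrightarrow> 0 < \<delta> \<Longrightarrow> bdd_above ((\<lambda>x. \<bar>(deriv ^^ k) s x\<bar>) ` {x. \<delta> < \<bar>x\<bar>})"
    and p_nonneg: "\<And>u x. 0 < u \<Longrightarrow> u < t0 \<Longrightarrow> 0 \<le> p u x"
    and p_density: "\<And>u. 0 < u \<Longrightarrow> u < t0 \<Longrightarrow> distributed M lborel (X u) (\<lambda>x. ennreal (p u x))"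
    and p_class: "\<And>u. 0 < u \<Longrightarrow> u < t0 \<Longrightarrow> class_C (2 * n + 1) (p u)"
    and p_bdd: "\<And>k \<delta>. k \<le> 2 * n + 1 \<Longrightarrow> 0 < \<delta> \<Longrightarrow>
      bdd_above ((\<lambda>(u, x). \<bar>(deriv ^^ k) (p u) x\<bar>) ` ({0<..<t0} \<times> {x. \<delta> < \<bar>x\<bar>}))"
    and N: "0 < N" and \<delta>: "0 < \<delta>" "\<delta> + 1 / real N < y - real (n + 1) * \<epsilon>"
begin

definition law :: "real \<Rightarrow> real measure" where
  "law u = distr M borel (X u)"

text \<open>Starting the sequence at N makes every window at most 1/N wide, so that bounds hold for
  all m, and excludes the degenerate index 0.\<close>

abbreviation moll_ind :: "nat \<Rightarrow> real \<Rightarrow> real" where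
  "moll_ind m \<equiv> mollified_indicator \<phi> y (m + N)"

abbreviation large_density :: "real \<Rightarrow> real" where
  "large_density \<equiv> \<lambda>x. (1 - c x) * s x"

lemma law: "0 \<le> u \<Longrightarrow> finite_borel (law u)"
  and measure_law: "0 \<le> u \<Longrightarrow> measure (law u) (space (law u)) = 1"
proof -
  assume "0 \<le> u"
  note [measurable] = X_measurable[OF this]
  interpret L: prob_space "law u" unfolding law_def by (rule prob_space_distr) simp
  show "finite_borel (law u)" by unfold_locales (simp add: law_def)
  show "measure (law u) (space (law u)) = 1" by (rule L.prob_space)
qed

lemma conv_law:
  assumes "0 \<le> u" "bdd_borel F"
  shows "conv (law u) F x = (LINT \<omega>|M. F (x + X u \<omega>))"
proof -
  note [measurable] = X_measurable[OF assms(1)] bdd_borel_measurable[OF assms(2)]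
  show ?thesis unfolding conv_def law_def by (rule integral_distr) measurable
qed

lemma law_eq_density:
  assumes "0 < u" "u < t0"
  shows "law u = density lborel (\<lambda>x. ennreal (p u x))"
proof -
  have "law u = distr M lborel (X u)"
    unfolding law_def by (rule distr_cong) auto
  then show ?thesis using distributed_distr_eq_density[OF p_density[OF assms]] by simp
qed

lemma smooth_bdd_moll_ind: "smooth_bdd (moll_ind m)"
  by (rule smooth_bdd_mollified_indicator) (use N in simp)

lemma moll_ind_bounds: "\<bar>moll_ind m x\<bar> \<le> 1"
  using phi_int_bounds N by (simp add: mollified_indicator_eq)

text \<open>No derivatives: the mollified indicators converge to the indicator except at \<open>y\<close>, which is
  not charged by the law of \<open>X u\<close>.\<close>

lemma term_tendsto_ell_0:
  fixes k0 k3 :: nat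
  assumes u: "0 < u" "u < t0"
  defines "T \<equiv> \<lambda>m. (conv (big_part c \<nu>) ^^ k3) (moll_ind m)"
  shows "(\<lambda>m. conv (law u) (T m) 0) \<longlonglongrightarrow>
      (LINT (u', w, \<beta>)|pi_meas c \<nu> (k0, 0, 0, k3, 0).
         measure M {\<omega> \<in> space M. X u \<omega> + (\<Sum>i=1..k3. u' i) \<ge> y})"
    and "\<bar>conv (law u) (T m) 0\<bar> \<le> measure (big_part c \<nu>) (space (big_part c \<nu>)) ^ k3"
proof -
  let ?B = "big_part c \<nu>"
  interpret L: finite_borel "law u" using u by (intro law) simp
  have f: "bdd_borel (moll_ind m)" for m
    by (rule smooth_bdd_imp_bdd_borel[OF smooth_bdd_moll_ind])
  show "\<bar>conv (law u) (T m) 0\<bar> \<le> measure ?B (space ?B) ^ k3"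
    using L.abs_integral_le[of "T m" 0 "1 * measure ?B (space ?B) ^ k3"] u f
      big.abs_conv_funpow_le[OF f moll_ind_bounds]
    by (simp add: T_def big.bdd_borel_conv_funpow measure_law)
  define f' where "f' x = (if x < y then 0 else if x = y then phi_int 0 else 1)" for x
  have f': "bdd_borel f'"
  proof (rule bdd_borelI[where C=1])
    show "f' \<in> borel_measurable borel" unfolding f'_def[abs_def] by measurable
    show "\<bar>f' x\<bar> \<le> 1" for x using phi_int_bounds[of 0] by (auto simp: f'_def)
  qed
  let ?I = "indicator {y..} :: real \<Rightarrow> real"
  have I: "bdd_borel ?I"
    by (intro bdd_borelI[where C=1]) (auto simp: indicator_def)
  have eq: "conv (law u) f' = conv (law u) ?I"
  proof
    fix x
    have [measurable]: "(\<lambda>z. p u z) \<in> borel_measurable borel"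
      by (rule borel_measurable_continuous_onI[OF class_C_continuous[OF p_class[OF u]]])
    have "AE z in lborel. z \<noteq> y - x" by (rule AE_lborel_singleton)
    then have "AE z in law u. z \<noteq> y - x"
      unfolding law_eq_density[OF u] by (subst AE_density) auto
    then have "AE z in law u. f' (x + z) = ?I (x + z)"
      by eventually_elim (auto simp: f'_def indicator_def)
    then show "conv (law u) f' x = conv (law u) ?I x"
      unfolding conv_def using bdd_borel_measurable[OF f'] bdd_borel_measurable[OF I]
      by (intro integral_cong_AE) auto
  qed
  \<comment> \<open>The law is moved innermost: once it has been applied, \<open>f'\<close> and the
    indicator give the same function at every point, and the large-jump convolutions never see the
    value at y.\<close>
  have "(\<lambda>m. (conv ?B ^^ k3) (conv (law u) (moll_ind m)) 0) \<longlonglongrightarrow> (conv ?B ^^ k3) (conv (law u) f') 0"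
  proof (rule big.conv_funpow_tendsto[where C=1])
    show "bdd_borel (conv (law u) (moll_ind m))" for m by (rule L.bdd_borel_conv[OF f])
    show "\<bar>conv (law u) (moll_ind m) x\<bar> \<le> 1" for m x
      using L.abs_integral_le[OF f moll_ind_bounds] u by (simp add: measure_law)
    show "(\<lambda>m. conv (law u) (moll_ind m) x) \<longlonglongrightarrow> conv (law u) f' x" for x
      unfolding f'_def
      by (rule L.conv_tendsto[OF f moll_ind_bounds]) (rule LIMSEQ_ignore_initial_segment[OF mollified_indicator_tendsto])
  qed
  moreover have "(conv ?B ^^ k3) (conv (law u) (moll_ind m)) = conv (law u) (T m)" for m
    unfolding T_def by (rule conv_commute_funpow[symmetric, OF L.finite_borel_axioms big.finite_borel_axioms f])
  moreover have "(conv ?B ^^ k3) (conv (law u) f') 0 = (LINT (u', w, \<beta>)|pi_meas c \<nu> (k0, 0, 0, k3, 0).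
         measure M {\<omega> \<in> space M. X u \<omega> + (\<Sum>i=1..k3. u' i) \<ge> y})"
  proof -
    have [measurable]: "X u \<in> borel_measurable M" using X_measurable u by simp
    have "measure M {\<omega> \<in> space M. X u \<omega> + x \<ge> y} = conv (law u) ?I x" for x
    proof -
      have "conv (law u) ?I x = (LINT \<omega>|M. ?I (x + X u \<omega>))"
        using u by (intro conv_law[OF _ I]) simp
      also have "\<dots> = (LINT \<omega>|M. indicator {\<omega> \<in> space M. X u \<omega> + x \<ge> y} \<omega>)"
        by (intro Bochner_Integration.integral_cong) (auto simp: indicator_def add.commute)
      also have "\<dots> = measure M ({\<omega> \<in> space M. X u \<omega> + x \<ge> y} \<inter> space M)"
        by (rule Bochner_Integration.integral_indicator)
      finally show ?thesis by (simp add: Int_absorb2)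
    qed
    then show ?thesis
      using integral_product_eq_conv[of "{1..k3}" "{1..0::nat}" "conv (law u) ?I" 0] I
      by (simp add: eq L.bdd_borel_conv)
  qed
  ultimately show "(\<lambda>m. conv (law u) (T m) 0) \<longlonglongrightarrow>
      (LINT (u', w, \<beta>)|pi_meas c \<nu> (k0, 0, 0, k3, 0).
         measure M {\<omega> \<in> space M. X u \<omega> + (\<Sum>i=1..k3. u' i) \<ge> y})"
    by simp
qed

text \<open>All derivatives but one are absorbed by the density of one of the large jumps.\<close>

lemma term_tendsto_large_jump:
  fixes k0 k1 k2 r k4 :: nat
  assumes u: "0 < u" "u < t0" and j: "j < 2 * n + 1" and C: "\<And>x. \<bar>(deriv ^^ j) large_density x\<bar> \<le> C"
  defines "T \<equiv> \<lambda>m. (conv (big_part c \<nu>) ^^ Suc r) ((conv kappa ^^ k4) ((deriv ^^ Suc j) (moll_ind m)))"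
  shows "(\<lambda>m. conv (law u) (T m) 0) \<longlonglongrightarrow> (- 1) ^ j *
      (LINT (u', w, \<beta>)|pi_tilde c \<nu> (k0, k1, k2, Suc r, k4).
           (LINT \<omega>|M. (deriv ^^ j) (\<lambda>x. (1 - c x) * s x)
              (y - X u \<omega> - (\<Sum>i=2..Suc r. u' i) - (\<Sum>j=1..k4. \<beta> j * w j))))"
    and "\<bar>conv (law u) (T m) 0\<bar> \<le> C * measure kappa (space kappa) ^ k4
      * measure (big_part c \<nu>) (space (big_part c \<nu>)) ^ r"
proof -
  let ?B = "big_part c \<nu>"
  interpret L: finite_borel "law u" using u by (intro law) simp
  have h: "class_C j large_density" "bdd_borel ((deriv ^^ j) large_density)"
    using class_C_large_density[OF s_diff s_bdd j] bdd_borel_large_density[OF s_diff s_bdd j] by auto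
  \<comment> \<open>At 0 the sign of s is unknown, but there the factor 1 - c is 0.\<close>
  have h_nonneg: "0 \<le> large_density x" for x
    using c_bounds[of x] s_nonneg[of x] c_eq_1[of 0] eps by (cases "x = 0") auto
  have B_density: "?B = density lborel (\<lambda>x. ennreal (large_density x))"
    by (rule big_part_eq_density[OF nu_density s_nonneg]) (use s_diff[of 0] in auto)
  define q where "q m x = (- 1) ^ j * mollify \<phi> (m + N) ((deriv ^^ j) large_density) (y - x)" for m x
  define H where "H x = (deriv ^^ j) large_density (y - x)" for x
  have Df: "smooth_bdd ((deriv ^^ Suc j) (moll_ind m))" for m
    by (rule smooth_bdd_funpow_deriv[OF smooth_bdd_moll_ind])
  have conv_f: "conv ?B ((deriv ^^ Suc j) (moll_ind m)) = q m" for m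
    unfolding B_density q_def using N by (intro ext conv_density_mollified_indicator h h_nonneg) auto
  \<comment> \<open>One of the r + 1 large-jump convolutions is carried past the small ones to meet
    the derivatives. Hence the remaining integral runs over u_2, u_3, ... only.\<close>
  have T: "T m = (conv ?B ^^ r) ((conv kappa ^^ k4) (q m))" for m
    unfolding T_def funpow_Suc_right[of r] comp_apply
    by (simp only: conv_commute_funpow[OF big.finite_borel_axioms kappa.finite_borel_axioms
        smooth_bdd_imp_bdd_borel[OF Df]] conv_f)
  have q: "bdd_borel (q m)" for m
    unfolding conv_f[symmetric] by (rule big.bdd_borel_conv[OF smooth_bdd_imp_bdd_borel[OF Df]])
  have q_bound: "\<bar>q m x\<bar> \<le> C" for m x
    unfolding q_def using abs_mollify_le[OF C] by (simp add: abs_mult power_abs)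
  have H_meas: "H \<in> borel_measurable borel"
    using bdd_borel_measurable[OF h(2)] unfolding H_def by measurable
  then have H: "bdd_borel H"
    by (rule bdd_borelI) (use C in \<open>auto simp: H_def\<close>)
  have q_lim: "(\<lambda>m. q m x) \<longlonglongrightarrow> (- 1) ^ j * H x" for x
    unfolding q_def H_def
    by (intro tendsto_intros LIMSEQ_ignore_initial_segment mollify_tendsto[OF _ C])
      (use class_C_funpow_continuous[OF h(1)] in simp)
  have k_bound: "\<bar>(conv kappa ^^ k4) (q m) x\<bar> \<le> C * measure kappa (space kappa) ^ k4" for m x
    by (rule kappa.abs_conv_funpow_le[OF q q_bound])
  have T_bound: "\<bar>T m x\<bar> \<le> C * measure kappa (space kappa) ^ k4 * measure ?B (space ?B) ^ r" for m x
    unfolding T by (rule big.abs_conv_funpow_le[OF kappa.bdd_borel_conv_funpow[OF q] k_bound])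
  have T_bdd: "bdd_borel (T m)" for m
    unfolding T by (intro big.bdd_borel_conv_funpow kappa.bdd_borel_conv_funpow q)
  show "\<bar>conv (law u) (T m) 0\<bar> \<le> C * measure kappa (space kappa) ^ k4 * measure ?B (space ?B) ^ r"
    using L.abs_integral_le[OF T_bdd T_bound] u by (simp add: measure_law)
  have "(\<lambda>m. (conv kappa ^^ k4) (q m) x) \<longlonglongrightarrow> (conv kappa ^^ k4) (\<lambda>x. (- 1) ^ j * H x) x" for x
    by (rule kappa.conv_funpow_tendsto[OF q q_bound q_lim])
  then have "(\<lambda>m. T m x) \<longlonglongrightarrow> (conv ?B ^^ r) ((conv kappa ^^ k4) (\<lambda>x. (- 1) ^ j * H x)) x" for x
    unfolding T by (rule big.conv_funpow_tendsto[OF kappa.bdd_borel_conv_funpow[OF q] k_bound])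
  then have "(\<lambda>m. conv (law u) (T m) 0)
    \<longlonglongrightarrow> conv (law u) ((conv ?B ^^ r) ((conv kappa ^^ k4) (\<lambda>x. (- 1) ^ j * H x))) 0"
    by (rule L.conv_tendsto[OF T_bdd T_bound])
  also have "conv (law u) ((conv ?B ^^ r) ((conv kappa ^^ k4) (\<lambda>x. (- 1) ^ j * H x))) 0
    = (- 1) ^ j * conv (law u) ((conv ?B ^^ r) ((conv kappa ^^ k4) H)) 0"
    by (simp add: kappa.conv_funpow_scale big.conv_funpow_scale L.conv_scale)
  \<comment> \<open>The expectation goes innermost, its place in the integral over
    \<open>pi_tilde\<close>.\<close>
  also have "conv (law u) ((conv ?B ^^ r) ((conv kappa ^^ k4) H)) = (conv ?B ^^ r) ((conv kappa ^^ k4) (conv (law u) H))"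
    by (simp add: conv_commute_funpow[OF L.finite_borel_axioms] big.finite_borel_axioms
        kappa.finite_borel_axioms kappa.bdd_borel_conv_funpow H)
  also have "(conv ?B ^^ r) ((conv kappa ^^ k4) (conv (law u) H)) 0 =
    (LINT (u', w, \<beta>)|pi_tilde c \<nu> (k0, k1, k2, Suc r, k4).
           (LINT \<omega>|M. (deriv ^^ j) (\<lambda>x. (1 - c x) * s x)
              (y - X u \<omega> - (\<Sum>i=2..Suc r. u' i) - (\<Sum>j=1..k4. \<beta> j * w j))))"
  proof -
    have "conv (law u) H (a + b) = (LINT \<omega>|M. (deriv ^^ j) (\<lambda>x. (1 - c x) * s x) (y - X u \<omega> - a - b))" for a b
      using u by (subst conv_law[OF _ H]) (auto simp: H_def algebra_simps)
    then show ?thesis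
      using integral_product_eq_conv[of "{2..Suc r}" "{1..k4}" "conv (law u) H" 0]
      by (simp add: L.bdd_borel_conv[OF H])
  qed
  finally show "(\<lambda>m. conv (law u) (T m) 0) \<longlonglongrightarrow> (- 1) ^ j *
      (LINT (u', w, \<beta>)|pi_tilde c \<nu> (k0, k1, k2, Suc r, k4).
           (LINT \<omega>|M. (deriv ^^ j) (\<lambda>x. (1 - c x) * s x)
              (y - X u \<omega> - (\<Sum>i=2..Suc r. u' i) - (\<Sum>j=1..k4. \<beta> j * w j))))" .
qed

text \<open>Without large jumps the derivatives fall on the density of \<open>X u\<close>; the small jumps move the
  argument by at most \<open>(n + 1) \<epsilon> < y\<close>, so it stays away from the origin.\<close>

lemma term_tendsto_no_large_jump:
  fixes k0 k1 k2 k4 :: nat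
  assumes u: "0 < u" "u < t0" and j: "j \<le> 2 * n + 1" and k4: "k4 \<le> n + 1"
    and C: "\<And>x. \<delta> < \<bar>x\<bar> \<Longrightarrow> \<bar>(deriv ^^ j) (p u) x\<bar> \<le> C"
  defines "T \<equiv> \<lambda>m. (conv kappa ^^ k4) ((deriv ^^ Suc j) (moll_ind m))"
  shows "(\<lambda>m. conv (law u) (T m) 0) \<longlonglongrightarrow> (- 1) ^ j *
      (LINT (u', w, \<beta>)|pi_meas c \<nu> (k0, k1, k2, 0, k4).
           (deriv ^^ j) (p u) (y - (\<Sum>j=1..k4. \<beta> j * w j)))"
    and "\<bar>conv (law u) (T m) 0\<bar> \<le> C * measure kappa (space kappa) ^ k4"
proof -
  interpret L: finite_borel "law u" using u by (intro law) simp
  have p: "class_C j (p u)" by (rule class_C_mono[OF p_class[OF u] j])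
  have cont: "continuous_on UNIV ((deriv ^^ j) (p u))"
    by (rule class_C_funpow_continuous[OF p order_refl])
  have "bounded ((deriv ^^ j) (p u) ` {-\<delta>..\<delta>})"
    by (intro compact_imp_bounded compact_continuous_image compact_Icc continuous_on_subset[OF cont]) auto
  then obtain C' where "\<forall>x\<in>{-\<delta>..\<delta>}. \<bar>(deriv ^^ j) (p u) x\<bar> \<le> C'"
    unfolding bounded_iff by auto
  then have C': "\<And>x. x \<in> {-\<delta>..\<delta>} \<Longrightarrow> \<bar>(deriv ^^ j) (p u) x\<bar> \<le> C'" by blast
  \<comment> \<open>A bound on the whole line, but one that depends on u: it serves the limit at a
    fixed time, while domination over all times has to use C.\<close>
  define C'' where "C'' = max C C'"
  have C'': "\<bar>(deriv ^^ j) (p u) x\<bar> \<le> C''" for x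
  proof (cases "\<delta> < \<bar>x\<bar>")
    case True
    then show ?thesis using C[of x] by (simp add: C''_def)
  next
    case False
    then have "x \<in> {-\<delta>..\<delta>}" by auto
    then show ?thesis using C'[of x] by (simp add: C''_def)
  qed
  define q where "q m x = (- 1) ^ j * mollify \<phi> (m + N) ((deriv ^^ j) (p u)) (y - x)" for m x
  define H where "H x = (deriv ^^ j) (p u) (y - x)" for x
  have Df: "smooth_bdd ((deriv ^^ Suc j) (moll_ind m))" for m
    by (rule smooth_bdd_funpow_deriv[OF smooth_bdd_moll_ind])
  have conv_f: "conv (law u) ((deriv ^^ Suc j) (moll_ind m)) = q m" for m
    unfolding law_eq_density[OF u] q_def
    using N by (intro ext conv_density_mollified_indicator p p_nonneg u) auto
  have T: "conv (law u) (T m) = (conv kappa ^^ k4) (q m)" for m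
    unfolding T_def by (simp only: conv_f
      conv_commute_funpow[OF L.finite_borel_axioms kappa.finite_borel_axioms smooth_bdd_imp_bdd_borel[OF Df]])
  have q: "bdd_borel (q m)" for m
    unfolding conv_f[symmetric] by (rule L.bdd_borel_conv[OF smooth_bdd_imp_bdd_borel[OF Df]])
  have q_bound: "\<bar>q m x\<bar> \<le> C''" for m x
    unfolding q_def using abs_mollify_le[OF C''] by (simp add: abs_mult power_abs)
  \<comment> \<open>Here the budget is spent: \<open>k4\<close> small jumps and the mollification
    window keep every evaluation of the derivative of the density outside [-\<delta>, \<delta>],
    where C applies.\<close>
  show "\<bar>conv (law u) (T m) 0\<bar> \<le> C * measure kappa (space kappa) ^ k4"
    unfolding T
  proof (rule kappa.abs_conv_funpow_le_local[OF kappa_support q])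
    fix z assume "\<bar>z - 0\<bar> \<le> real k4 * \<epsilon>"
    moreover have "real k4 * \<epsilon> \<le> real (n + 1) * \<epsilon>"
      using k4 eps by (intro mult_right_mono) auto
    ultimately have z: "\<bar>z\<bar> \<le> real (n + 1) * \<epsilon>" by simp
    have "\<bar>mollify \<phi> (m + N) ((deriv ^^ j) (p u)) (y - z)\<bar> \<le> C"
    proof (rule abs_mollify_le, rule C)
      fix v :: real assume v: "\<bar>v\<bar> \<le> 1"
      have "\<bar>v / real (m + N)\<bar> \<le> 1 / real N"
        using v N by (auto simp: abs_divide intro!: frac_le)
      with z \<delta> show "\<delta> < \<bar>y - z + v / real (m + N)\<bar>" by linarith
    qed
    then show "\<bar>q m z\<bar> \<le> C" by (simp add: q_def abs_mult power_abs)
  qed (use eps in simp)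
  have "continuous_on UNIV H"
    unfolding H_def by (rule continuous_on_compose2[OF cont]) (auto intro!: continuous_intros)
  then have H: "bdd_borel H"
    by (intro bdd_borelI[where C=C''] borel_measurable_continuous_onI) (use C'' in \<open>auto simp: H_def\<close>)
  have q_lim: "(\<lambda>m. q m x) \<longlonglongrightarrow> (- 1) ^ j * H x" for x
    unfolding q_def H_def by (intro tendsto_intros LIMSEQ_ignore_initial_segment mollify_tendsto[OF cont C''])
  have "(\<lambda>m. (conv kappa ^^ k4) (q m) 0) \<longlonglongrightarrow> (conv kappa ^^ k4) (\<lambda>x. (- 1) ^ j * H x) 0"
    by (rule kappa.conv_funpow_tendsto[OF q q_bound q_lim])
  also have "(conv kappa ^^ k4) (\<lambda>x. (- 1) ^ j * H x) 0 = (- 1) ^ j * (conv kappa ^^ k4) H 0"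
    by (simp add: kappa.conv_funpow_scale)
  also have "(conv kappa ^^ k4) H 0 = (LINT (u', w, \<beta>)|pi_meas c \<nu> (k0, k1, k2, 0, k4).
           (deriv ^^ j) (p u) (y - (\<Sum>j=1..k4. \<beta> j * w j)))"
    using integral_product_eq_conv[of "{1..0::nat}" "{1..k4}" H 0] H by (simp add: H_def)
  finally show "(\<lambda>m. conv (law u) (T m) 0) \<longlonglongrightarrow> (- 1) ^ j *
      (LINT (u', w, \<beta>)|pi_meas c \<nu> (k0, k1, k2, 0, k4).
           (deriv ^^ j) (p u) (y - (\<Sum>j=1..k4. \<beta> j * w j)))"
    unfolding T .
qed

text \<open>B is obtained before u and m, so that one constant dominates in the later limit under
  the integral over \<alpha>.\<close>

lemma expansion_term_tendsto:
  fixes k0 k1 k2 k3 k4 :: nat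
  assumes k: "(k0, k1, k2, k3, k4) \<in> idx_set (n + 1)" (is "?k \<in> _")
  defines "sg \<equiv> (- 1) powi ((int k1 - 1) * (if 0 < ell (k0, k1, k2, k3, k4) then 1 else 0))"
  obtains B where
    "\<And>u m. 0 < u \<Longrightarrow> u < t0 \<Longrightarrow> \<bar>conv (law u) (expansion_term (moll_ind m) ?k) 0\<bar> \<le> B"
    "\<And>t \<alpha>. 0 < \<alpha> * t \<Longrightarrow> \<alpha> * t < t0 \<Longrightarrow>
      (\<lambda>m. conv (law (\<alpha> * t)) (expansion_term (moll_ind m) ?k) 0) \<longlonglongrightarrow> sg * a_coeff M X p s c \<nu> ?k t \<alpha> y"
proof (cases "ell ?k")
  case 0
  then have k': "k1 = 0" "k2 = 0" "k4 = 0" by auto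
  show ?thesis
  proof (rule that)
    fix u m assume u: "0 < u" "u < t0"
    show "\<bar>conv (law u) (expansion_term (moll_ind m) ?k) 0\<bar> \<le> measure (big_part c \<nu>) (space (big_part c \<nu>)) ^ k3"
      using term_tendsto_ell_0(2)[OF u] by (simp add: k')
  next
    fix t \<alpha> assume u: "0 < \<alpha> * t" "\<alpha> * t < t0"
    show "(\<lambda>m. conv (law (\<alpha> * t)) (expansion_term (moll_ind m) ?k) 0) \<longlonglongrightarrow> sg * a_coeff M X p s c \<nu> ?k t \<alpha> y"
      using term_tendsto_ell_0(1)[OF u, of k3 k0] by (simp add: k' sg_def Let_def)
  qed
next
  case (Suc j)
  have sg: "sg = (- 1) ^ j"
    using neg_one_powi_ell[of k1 k2 k4 j] Suc by (simp add: sg_def)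
  have sum_k: "k0 + k1 + k2 + k3 + k4 = n + 1" using k by (simp add: idx_set_def)
  show ?thesis
  proof (cases k3)
    case 0
    \<comment> \<open>All n + 1 indices may be of second order, so l reaches 2 n + 2 and l - 1 uses
      up the assumed 2 n + 1 derivatives of the density.\<close>
    have j: "j \<le> 2 * n + 1" using Suc sum_k by simp
    have k4: "k4 \<le> n + 1" using sum_k by simp
    obtain C where
      C': "\<And>v. v \<in> (\<lambda>(u, x). \<bar>(deriv ^^ j) (p u) x\<bar>) ` ({0<..<t0} \<times> {x. \<delta> < \<bar>x\<bar>}) \<Longrightarrow> v \<le> C"
      using p_bdd[OF j \<delta>(1)] unfolding bdd_above_def by blast
    have C: "\<bar>(deriv ^^ j) (p u) x\<bar> \<le> C" if "0 < u" "u < t0" "\<delta> < \<bar>x\<bar>" for u x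
      by (rule C', rule image_eqI[of _ _ "(u, x)"]) (use that in auto)
    show ?thesis
    proof (rule that)
      fix u m assume u: "0 < u" "u < t0"
      show "\<bar>conv (law u) (expansion_term (moll_ind m) ?k) 0\<bar> \<le> C * measure kappa (space kappa) ^ k4"
        using term_tendsto_no_large_jump(2)[OF u j k4 C[OF u]] Suc by (simp add: 0 del: ell.simps funpow.simps)
    next
      fix t \<alpha> assume u: "0 < \<alpha> * t" "\<alpha> * t < t0"
      show "(\<lambda>m. conv (law (\<alpha> * t)) (expansion_term (moll_ind m) ?k) 0) \<longlonglongrightarrow> sg * a_coeff M X p s c \<nu> ?k t \<alpha> y"
        using term_tendsto_no_large_jump(1)[OF u j k4 C[OF u], of k0 k1 k2] Suc
        by (simp add: 0 sg Let_def del: ell.simps funpow.simps pi_meas.simps)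
    qed
  next
    case k3: (Suc r)
    \<comment> \<open>A large jump occupies one index, so l \<le> 2 n; the strict inequality is what
      makes the j-th derivative of the jump density continuous.\<close>
    have j: "j < 2 * n + 1" using Suc sum_k k3 by simp
    obtain C where C: "\<And>x. \<bar>(deriv ^^ j) large_density x\<bar> \<le> C"
      using bdd_borel_bound[OF bdd_borel_large_density[OF s_diff s_bdd j]] by metis
    show ?thesis
    proof (rule that)
      fix u m assume u: "0 < u" "u < t0"
      show "\<bar>conv (law u) (expansion_term (moll_ind m) ?k) 0\<bar> \<le> C * measure kappa (space kappa) ^ k4
          * measure (big_part c \<nu>) (space (big_part c \<nu>)) ^ r"
        using term_tendsto_large_jump(2)[OF u j C] Suc by (simp add: k3 del: ell.simps funpow.simps)
    next
      fix t \<alpha> assume u: "0 < \<alpha> * t" "\<alpha> * t < t0"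
      show "(\<lambda>m. conv (law (\<alpha> * t)) (expansion_term (moll_ind m) ?k) 0) \<longlonglongrightarrow> sg * a_coeff M X p s c \<nu> ?k t \<alpha> y"
        using term_tendsto_large_jump(1)[OF u j C, of r k4 k0 k1 k2] Suc
        by (simp add: k3 sg Let_def del: ell.simps funpow.simps pi_tilde.simps)
    qed
  qed
qed

end

section \<open>Passing to the limit in the integral over \<alpha>\<close>

lemma tendsto_LBINT_unit_interval:
  fixes f :: "nat \<Rightarrow> real \<Rightarrow> real"
  assumes meas: "\<And>m. (\<lambda>\<alpha>. indicator {0..1} \<alpha> *\<^sub>R f m \<alpha>) \<in> borel_measurable borel"
    and bound: "\<And>m \<alpha>. \<alpha> \<in> {0<..1} \<Longrightarrow> \<bar>f m \<alpha>\<bar> \<le> B"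
    and lim: "\<And>\<alpha>. \<alpha> \<in> {0<..1} \<Longrightarrow> (\<lambda>m. f m \<alpha>) \<longlonglongrightarrow> g \<alpha>"
  shows "(\<lambda>m. LBINT \<alpha>:{0..1}. f m \<alpha>) \<longlonglongrightarrow> (LBINT \<alpha>:{0..1}. g \<alpha>)"
proof -
  \<comment> \<open>Bounds and limits are available for \<alpha> > 0 only, since \<open>X 0\<close>
    has no density. The null point 0 is discarded, and measurability on the closed interval is
    regained by adding a singleton.\<close>
  have drop_0: "(LBINT \<alpha>:{0..1}. h \<alpha>) = (LBINT \<alpha>. indicator {0<..1} \<alpha> * h \<alpha>)"
    if h: "(\<lambda>\<alpha>. indicator {0<..1} \<alpha> * h \<alpha>) \<in> borel_measurable borel" for h :: "real \<Rightarrow> real"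
  proof -
    have "(\<lambda>\<alpha>. indicator {0<..1} \<alpha> * h \<alpha> + indicator {0} \<alpha> * h 0) \<in> borel_measurable borel"
      by (intro borel_measurable_add h) measurable
    also have "(\<lambda>\<alpha>. indicator {0<..1} \<alpha> * h \<alpha> + indicator {0} \<alpha> * h 0) = (\<lambda>\<alpha>. indicator {0..1} \<alpha> *\<^sub>R h \<alpha>)"
      by (auto simp: indicator_def fun_eq_iff)
    finally have h': "(\<lambda>\<alpha>. indicator {0..1} \<alpha> *\<^sub>R h \<alpha>) \<in> borel_measurable borel" .
    have "AE \<alpha> in lborel. \<alpha> \<noteq> (0 :: real)" by (rule AE_lborel_singleton)
    then have "AE \<alpha> in lborel. indicator {0..1} \<alpha> *\<^sub>R h \<alpha> = indicator {0<..1} \<alpha> * h \<alpha>"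
      by eventually_elim (auto simp: indicator_def)
    then show ?thesis
      unfolding set_lebesgue_integral_def using h h' by (intro integral_cong_AE) auto
  qed
  let ?f = "\<lambda>m \<alpha>. indicator {0<..1} \<alpha> * f m \<alpha>" and ?g = "\<lambda>\<alpha>. indicator {0<..1} \<alpha> * g \<alpha>"
  have f_meas: "?f m \<in> borel_measurable borel" for m
  proof -
    have "(\<lambda>\<alpha>. indicator {0<..1} \<alpha> * (indicator {0..1} \<alpha> *\<^sub>R f m \<alpha>)) \<in> borel_measurable borel"
      by (intro borel_measurable_times meas) measurable
    also have "(\<lambda>\<alpha>. indicator {0<..1} \<alpha> * (indicator {0..1} \<alpha> *\<^sub>R f m \<alpha>)) = ?f m"
      by (auto simp: indicator_def fun_eq_iff)
    finally show ?thesis .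
  qed
  have f_lim: "(\<lambda>m. ?f m \<alpha>) \<longlonglongrightarrow> ?g \<alpha>" for \<alpha>
    using lim[of \<alpha>] by (cases "\<alpha> \<in> {0<..1}") auto
  \<comment> \<open>The limit inherits measurability, so nothing has to be known about the product
    integrals as functions of \<alpha>.\<close>
  have g_meas: "?g \<in> borel_measurable borel"
    by (rule borel_measurable_LIMSEQ_real[OF f_lim f_meas])
  have B: "0 \<le> B" using bound[of 1 0] by simp
  have "(\<lambda>m. integral\<^sup>L lborel (?f m)) \<longlonglongrightarrow> integral\<^sup>L lborel ?g"
  proof (rule integral_dominated_convergence[where w="\<lambda>\<alpha>. indicator {0..1} \<alpha> *\<^sub>R B"])
    show "AE \<alpha> in lborel. norm (?f m \<alpha>) \<le> indicator {0..1} \<alpha> *\<^sub>R B" for m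
      using bound[of _ m] B by (intro AE_I2) (auto simp: indicator_def)
  qed (use f_meas g_meas f_lim in auto)
  then show ?thesis by (simp add: drop_0 f_meas g_meas)
qed

theorem theorem5p1:
  fixes M :: "'a measure"
    and X :: "real \<Rightarrow> 'a \<Rightarrow> real"
    and \<sigma> b y \<epsilon> t0 t :: real
    and \<nu> :: "real measure"
    and s c \<phi> :: "real \<Rightarrow> real"
    and p :: "real \<Rightarrow> real \<Rightarrow> real"
    and n :: nat
  assumes "0 < y" and "1 \<le> n"
    and "0 < \<epsilon>" and "\<epsilon> < min (y / real (n + 1)) 1"
    and "bump \<phi>" and "truncation \<epsilon> c"
    and "levy_process M X" and "has_levy_triplet M X \<sigma> b \<nu>"
    and "\<nu> = density lborel (\<lambda>x. ennreal (s x))"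
    and "\<forall>x. x \<noteq> 0 \<longrightarrow> 0 \<le> s x"
    and "\<forall>k<2 * n + 1. \<forall>x. x \<noteq> 0 \<longrightarrow> (deriv ^^ k) s differentiable (at x)"
    and "\<forall>k\<le>2 * n + 1. \<forall>\<delta>>0. bdd_above ((\<lambda>x. \<bar>(deriv ^^ k) s x\<bar>) ` {x. \<delta> < \<bar>x\<bar>})"
    and "0 < t0"
    and "\<forall>u. 0 < u \<and> u < t0 \<longrightarrow>
           (\<forall>x. 0 \<le> p u x) \<and> distributed M lborel (X u) (\<lambda>x. ennreal (p u x)) \<and>
           class_C (2 * n + 1) (p u)"
    and "\<forall>k\<le>2 * n + 1. \<forall>\<delta>>0.
           bdd_above ((\<lambda>(u, x). \<bar>(deriv ^^ k) (p u) x\<bar>) ` ({0<..<t0} \<times> {x. \<delta> < \<bar>x\<bar>}))"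
    and "0 < t" and "t < t0"
  shows "(\<lambda>m. LBINT \<alpha>:{0..1}. (1 - \<alpha>)^n *
            (LINT \<omega>|M. (levy_generator \<sigma> b \<nu> ^^ (n + 1)) (mollified_indicator \<phi> y m) (X (\<alpha> * t) \<omega>)))
         \<longlonglongrightarrow>
         (\<Sum>k\<in>idx_set (n + 1). c_coeff \<sigma> b c \<nu> k * multinom k *
            (LBINT \<alpha>:{0..1}. (1 - \<alpha>)^n * a_coeff M X p s c \<nu> k t \<alpha> y))"
proof -
  have "real (n + 1) * \<epsilon> < y" using assms(4) by (simp add: field_simps)
  \<comment> \<open>The gap is halved: one half is the distance kept from the origin, the other
    leaves room for a window of width 1/N < \<delta>.\<close>
  define \<delta> where "\<delta> = (y - real (n + 1) * \<epsilon>) / 2"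
  have \<delta>: "0 < \<delta>" using \<open>real (n + 1) * \<epsilon> < y\<close> by (simp add: \<delta>_def)
  obtain N' :: nat where "1 / \<delta> < real N'" using reals_Archimedean2 by blast
  define N where "N = Suc N'"
  have N: "0 < N" "1 / \<delta> < real N" using \<open>1 / \<delta> < real N'\<close> by (simp_all add: N_def)
  have "1 / real N < \<delta>" using N \<delta> by (simp add: field_simps)
  then have \<delta>N: "\<delta> + 1 / real N < y - real (n + 1) * \<epsilon>" by (simp add: \<delta>_def field_simps)
  interpret remainder_terms \<epsilon> c \<nu> \<phi> M X s p t0 y \<delta> n N
    using assms \<delta> \<delta>N N unfolding levy_process_def has_levy_triplet_def
    by (intro remainder_terms.intro truncated_levy.intro bump_function.intro remainder_terms_axioms.intro) auto
  let ?E = "\<lambda>k m \<alpha>. LINT \<omega>|M. expansion_term (moll_ind m) k (X (\<alpha> * t) \<omega>)"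
  let ?b = "\<lambda>k :: idx. case k of (k0, k1, k2, k3, k4) \<Rightarrow> b0 c \<nu> ^ k0 * b1 b c \<nu> ^ k1 * b2 \<sigma> ^ k2"
  let ?sg = "\<lambda>k :: idx. case k of (k0, k1, k2, k3, k4) \<Rightarrow>
    (- 1 :: real) powi ((int k1 - 1) * (if 0 < ell (k0, k1, k2, k3, k4) then 1 else 0))"
  have T: "smooth_bdd (expansion_term (moll_ind m) k)" for m k
    by (rule smooth_bdd_expansion_term[OF smooth_bdd_moll_ind])
  have E_conv: "?E k m \<alpha> = conv (law (\<alpha> * t)) (expansion_term (moll_ind m) k) 0" if "0 \<le> \<alpha>" for k m \<alpha>
    using that \<open>0 < t\<close> by (subst conv_law[OF _ smooth_bdd_imp_bdd_borel[OF T]]) auto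
  have E_bound: "\<exists>C. \<forall>\<alpha>\<ge>0. \<bar>?E k m \<alpha>\<bar> \<le> C" for k m
  proof -
    obtain C where C: "\<And>x. \<bar>expansion_term (moll_ind m) k x\<bar> \<le> C"
      using bdd_borel_bound[OF smooth_bdd_imp_bdd_borel[OF T]] by metis
    have "\<bar>?E k m \<alpha>\<bar> \<le> C" if "0 \<le> \<alpha>" for \<alpha>
    proof -
      have u: "0 \<le> \<alpha> * t" using that \<open>0 < t\<close> by simp
      interpret L: finite_borel "law (\<alpha> * t)" by (rule law[OF u])
      show ?thesis
        using L.abs_integral_le[OF smooth_bdd_imp_bdd_borel[OF T] C, of 0]
        by (simp add: E_conv[OF that] measure_law[OF u])
    qed
    then show ?thesis by blast
  qed
  have E_measurable: "(\<lambda>\<alpha>. indicator {0..} \<alpha> * ?E k m \<alpha>) \<in> borel_measurable borel" for k m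
  proof -
    obtain C where C: "\<And>x. \<bar>expansion_term (moll_ind m) k x\<bar> \<le> C"
      using bdd_borel_bound[OF smooth_bdd_imp_bdd_borel[OF T]] by metis
    show ?thesis
      by (rule measurable_expectation_levy_process[OF assms(7) _ C \<open>0 < t\<close>])
        (simp add: continuous_on_eq_continuous_at smooth_bdd_isCont[OF T])
  qed
  have F_measurable [measurable]: "(\<lambda>\<alpha>. indicator {0..1} \<alpha> *\<^sub>R ((1 - \<alpha>) ^ n * ?E k m \<alpha>)) \<in> borel_measurable borel" for k m
  proof -
    have "(\<lambda>\<alpha>. indicator {0..1} \<alpha> * (1 - \<alpha>) ^ n * (indicator {0..} \<alpha> * ?E k m \<alpha>)) \<in> borel_measurable borel"
      by (intro borel_measurable_times E_measurable) measurable
    also have "(\<lambda>\<alpha>. indicator {0..1} \<alpha> * (1 - \<alpha>) ^ n * (indicator {0..} \<alpha> * ?E k m \<alpha>))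
      = (\<lambda>\<alpha>. indicator {0..1} \<alpha> *\<^sub>R ((1 - \<alpha>) ^ n * ?E k m \<alpha>))"
      by (auto simp: indicator_def fun_eq_iff)
    finally show ?thesis .
  qed
  have pow_le: "\<bar>(1 - \<alpha>) ^ n\<bar> \<le> 1" if "\<alpha> \<in> {0..1}" for \<alpha> :: real
    using that by (simp add: power_le_one)
  have F_le: "norm (indicator {0..1} \<alpha> *\<^sub>R ((1 - \<alpha>) ^ n * e)) \<le> indicator {0..1} \<alpha> *\<^sub>R C"
    if "\<alpha> \<in> {0..1} \<Longrightarrow> \<bar>e\<bar> \<le> C" for \<alpha> e C :: real
  proof (cases "\<alpha> \<in> {0..1}")
    case True
    then show ?thesis
      using mult_mono[OF pow_le[OF True] that[OF True]] by (simp add: abs_mult)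
  qed simp
  have int_const: "integrable lborel (\<lambda>\<alpha>::real. indicator {0..1} \<alpha> *\<^sub>R C)" for C :: real
    by simp
  have F_integrable: "set_integrable lborel {0..1} (\<lambda>\<alpha>. (1 - \<alpha>) ^ n * ?E k m \<alpha>)" for k m
  proof -
    obtain C where C: "\<forall>\<alpha>\<ge>0. \<bar>?E k m \<alpha>\<bar> \<le> C" using E_bound by blast
    show ?thesis
      unfolding set_integrable_def
    proof (rule Bochner_Integration.integrable_bound[OF int_const[of C]])
      show "AE \<alpha> in lborel. norm (indicator {0..1} \<alpha> *\<^sub>R ((1 - \<alpha>) ^ n * ?E k m \<alpha>)) \<le> norm (indicator {0..1} \<alpha> *\<^sub>R C)"
      proof (intro AE_I2 order_trans[OF F_le])
        show "\<bar>?E k m \<alpha>\<bar> \<le> C" if "\<alpha> \<in> {0..1}" for \<alpha> using C that by simp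
      qed simp
    qed (simp only: measurable_lborel1 measurable_lborel2 F_measurable)
  qed
  define a where "a k = multinom k * ?b k" for k
  \<comment> \<open>For fixed m every term is bounded, with a bound that may depend on m; this
    suffices to take the finite sum out of both integrals before the limit is considered.\<close>
  have expand: "(LBINT \<alpha>:{0..1}. (1 - \<alpha>)^n *
      (LINT \<omega>|M. (levy_generator \<sigma> b \<nu> ^^ (n + 1)) (moll_ind m) (X (\<alpha> * t) \<omega>)))
    = (\<Sum>k\<in>idx_set (n + 1). a k * (LBINT \<alpha>:{0..1}. (1 - \<alpha>)^n * ?E k m \<alpha>))" for m
  proof -
    have gen: "(levy_generator \<sigma> b \<nu> ^^ (n + 1)) (moll_ind m)
      = (\<lambda>x. \<Sum>k\<in>idx_set (n + 1). a k * expansion_term (moll_ind m) k x)"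
      unfolding levy_generator_funpow[OF smooth_bdd_moll_ind] a_def by (simp only: mult.assoc)
    have E_sum: "(LINT \<omega>|M. (levy_generator \<sigma> b \<nu> ^^ (n + 1)) (moll_ind m) (X (\<alpha> * t) \<omega>))
      = (\<Sum>k\<in>idx_set (n + 1). a k * ?E k m \<alpha>)" if "\<alpha> \<in> {0..1}" for \<alpha>
    proof -
      have X: "X (\<alpha> * t) \<in> borel_measurable M" using X_measurable that \<open>0 < t\<close> by simp
      have int: "integrable M (\<lambda>\<omega>. expansion_term (moll_ind m) k (X (\<alpha> * t) \<omega>))" for k
      proof -
        obtain C where C: "\<And>x. \<bar>expansion_term (moll_ind m) k x\<bar> \<le> C"
          using bdd_borel_bound[OF smooth_bdd_imp_bdd_borel[OF T]] by metis
        show ?thesis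
        proof (rule integrable_const_bound[of _ C, OF AE_I2])
          show "(\<lambda>\<omega>. expansion_term (moll_ind m) k (X (\<alpha> * t) \<omega>)) \<in> borel_measurable M"
            by (rule measurable_compose[OF X bdd_borel_measurable[OF smooth_bdd_imp_bdd_borel[OF T]]])
        qed (simp only: real_norm_def C)
      qed
      show ?thesis
        unfolding gen
        by (subst Bochner_Integration.integral_sum)
          (rule integrable_mult_right, rule int, simp only: integral_mult_right_zero)
    qed
    have "(LBINT \<alpha>:{0..1}. (1 - \<alpha>)^n *
        (LINT \<omega>|M. (levy_generator \<sigma> b \<nu> ^^ (n + 1)) (moll_ind m) (X (\<alpha> * t) \<omega>)))
      = (LBINT \<alpha>. (\<Sum>k\<in>idx_set (n + 1). a k * (indicator {0..1} \<alpha> *\<^sub>R ((1 - \<alpha>)^n * ?E k m \<alpha>))))"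
      unfolding set_lebesgue_integral_def
    proof (rule Bochner_Integration.integral_cong[OF refl])
      fix \<alpha> :: real
      show "indicator {0..1} \<alpha> *\<^sub>R ((1 - \<alpha>)^n *
          (LINT \<omega>|M. (levy_generator \<sigma> b \<nu> ^^ (n + 1)) (moll_ind m) (X (\<alpha> * t) \<omega>)))
        = (\<Sum>k\<in>idx_set (n + 1). a k * (indicator {0..1} \<alpha> *\<^sub>R ((1 - \<alpha>)^n * ?E k m \<alpha>)))"
      proof (cases "\<alpha> \<in> {0..1}")
        case True
        show ?thesis unfolding E_sum[OF True] real_scaleR_def sum_distrib_left
          by (simp only: mult_ac)
      qed simp
    qed
    also have "\<dots> = (\<Sum>k\<in>idx_set (n + 1). (LBINT \<alpha>. a k * (indicator {0..1} \<alpha> *\<^sub>R ((1 - \<alpha>)^n * ?E k m \<alpha>))))"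
      using F_integrable unfolding set_integrable_def
      by (intro Bochner_Integration.integral_sum integrable_mult_right)
    finally show ?thesis
      unfolding set_lebesgue_integral_def by (simp only: integral_mult_right_zero)
  qed
  have lim: "(\<lambda>m. LBINT \<alpha>:{0..1}. (1 - \<alpha>)^n * ?E k m \<alpha>) \<longlonglongrightarrow>
      ?sg k * (LBINT \<alpha>:{0..1}. (1 - \<alpha>)^n * a_coeff M X p s c \<nu> k t \<alpha> y)" if k: "k \<in> idx_set (n + 1)" for k
  proof -
    obtain k0 k1 k2 k3 k4 where k_eq: "k = (k0, k1, k2, k3, k4)" by (cases k)
    obtain B where
      B: "\<And>u m. 0 < u \<Longrightarrow> u < t0 \<Longrightarrow> \<bar>conv (law u) (expansion_term (moll_ind m) k) 0\<bar> \<le> B"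
      and L: "\<And>t \<alpha>. 0 < \<alpha> * t \<Longrightarrow> \<alpha> * t < t0 \<Longrightarrow>
        (\<lambda>m. conv (law (\<alpha> * t)) (expansion_term (moll_ind m) k) 0) \<longlonglongrightarrow> ?sg k * a_coeff M X p s c \<nu> k t \<alpha> y"
      using expansion_term_tendsto[of k0 k1 k2 k3 k4] k unfolding k_eq prod.case by blast
    have u: "0 < \<alpha> * t" "\<alpha> * t < t0" if "\<alpha> \<in> {0<..1}" for \<alpha>
    proof -
      show "0 < \<alpha> * t" using that \<open>0 < t\<close> by simp
      have "\<alpha> * t \<le> 1 * t" using that \<open>0 < t\<close> by (intro mult_right_mono) auto
      then show "\<alpha> * t < t0" using \<open>t < t0\<close> by simp
    qed
    have "(\<lambda>m. LBINT \<alpha>:{0..1}. (1 - \<alpha>)^n * ?E k m \<alpha>) \<longlonglongrightarrow>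
      (LBINT \<alpha>:{0..1}. (1 - \<alpha>)^n * (?sg k * a_coeff M X p s c \<nu> k t \<alpha> y))"
    proof (rule tendsto_LBINT_unit_interval[OF F_measurable])
      fix \<alpha> :: real assume \<alpha>: "\<alpha> \<in> {0<..1}"
      then have E: "?E k m \<alpha> = conv (law (\<alpha> * t)) (expansion_term (moll_ind m) k) 0" for m
        by (intro E_conv) simp
      have "\<bar>?E k m \<alpha>\<bar> \<le> B" for m unfolding E by (rule B[OF u[OF \<alpha>]])
      moreover have "\<bar>(1 - \<alpha>) ^ n\<bar> \<le> 1" using \<alpha> by (intro pow_le) simp
      ultimately have "\<bar>(1 - \<alpha>) ^ n\<bar> * \<bar>?E k m \<alpha>\<bar> \<le> 1 * B" for m
        by (intro mult_mono) (simp_all only: abs_ge_zero zero_le_one)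
      then show "\<bar>(1 - \<alpha>) ^ n * ?E k m \<alpha>\<bar> \<le> B" for m by (simp only: abs_mult mult_1_left)
      show "(\<lambda>m. (1 - \<alpha>) ^ n * ?E k m \<alpha>) \<longlonglongrightarrow> (1 - \<alpha>) ^ n * (?sg k * a_coeff M X p s c \<nu> k t \<alpha> y)"
        unfolding E by (intro tendsto_mult tendsto_const L u \<alpha>)
    qed
    then show ?thesis by (simp only: mult.left_commute[of _ "?sg k"] set_integral_mult_right)
  qed
  have "(\<lambda>m. LBINT \<alpha>:{0..1}. (1 - \<alpha>)^n *
      (LINT \<omega>|M. (levy_generator \<sigma> b \<nu> ^^ (n + 1)) (moll_ind m) (X (\<alpha> * t) \<omega>)))
    \<longlonglongrightarrow> (\<Sum>k\<in>idx_set (n + 1). a k *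
      (?sg k * (LBINT \<alpha>:{0..1}. (1 - \<alpha>)^n * a_coeff M X p s c \<nu> k t \<alpha> y)))"
    unfolding expand by (intro tendsto_sum tendsto_mult tendsto_const lim)
  also have "(\<Sum>k\<in>idx_set (n + 1). a k *
      (?sg k * (LBINT \<alpha>:{0..1}. (1 - \<alpha>)^n * a_coeff M X p s c \<nu> k t \<alpha> y)))
    = (\<Sum>k\<in>idx_set (n + 1). c_coeff \<sigma> b c \<nu> k * multinom k *
            (LBINT \<alpha>:{0..1}. (1 - \<alpha>)^n * a_coeff M X p s c \<nu> k t \<alpha> y))"
    by (intro sum.cong refl)
      (auto simp: a_def mult_ac simp del: multinom.simps a_coeff.simps ell.simps)
  \<comment> \<open>The limit was proved for the sequence shifted by N; undoing the shift does not
    change it.\<close>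
  finally show ?thesis by (rule LIMSEQ_offset)
qed

end
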